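(* A permutation sequence $(\sigma_n)_{n\in\mathbb N}$ is convergent if and only if it is a Cauchy sequence with respect to the metric $d_\square$, i.e. for every $\varepsilon>0$ there is $n_0$ such that $d_\square(\sigma_n,\sigma_m)<\varepsilon$ for all $n,m\ge n_0$.
   Context: For a positive integer $n$, $S_n$ denotes the set of permutations of $[n]=\{1,\dots,n\}$, and $\mathcal S=\bigcup_{n\ge1}S_n$. For $\tau\in S_k$ and $\pi\in S_n$, let $\Lambda(\tau,\pi)$ be the number of $k$-tuples $(x_1,\dots,x_k)$ with $1\le x_1<\dots<x_k\le n$ such that for all $i,j\in[k]$, $\pi(x_i)<\pi(x_j)$ iff $\tau(i)<\tau(j)$; $t(\tau,\pi)=\binom nk^{-1}\Lambda(\tau,\pi)$ if $k\le n$ and $0$ if $k>n$. A permutation sequence $(\sigma_n)$ is convergent if for every $\tau\in\mathcal S$ the sequence $(t(\tau,\sigma_n))_n$ converges. For $\sigma\in S_n$ define $Z_\sigma:[0,1]^2\to[0,1]$ by $Z_\sigma(x,y)=\min\{1,\max\{0,\,ny-\sigma(\lceil nx\rceil)+1\}\}$ for $x\in(0,1]$ and $Z_\sigma(0,y)=y$. For measurable $Z_1,Z_2:[0,1]^2\to[0,1]$ let $$d_\square(Z_1,Z_2)=\sup_{0\le x_1<x_2\le1,\ 0\le y_1<y_2\le1}\Big|\int_{x_1}^{x_2}(Z_1(x,y_2)-Z_1(x,y_1))\,dx-\int_{x_1}^{x_2}(Z_2(x,y_2)-Z_2(x,y_1))\,dx\Big|,$$ and for permutations $\sigma,\pi\in\mathcal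 S$ (possibly of different lengths) let $d_\square(\sigma,\pi)=d_\square(Z_\sigma,Z_\pi)$. (For $\sigma,\pi\in S_n$ this equals $\frac1n\max_{S,T}\big||\sigma(S)\cap T|-|\pi(S)\cap T|\big|$ over intervals $S,T$ of $[n]$.)
   Formalization: "Cauchy implies convergent" is stated only when the lengths of σ_n stay bounded or tend to infinity; without this it fails (alternate the length-1 permutation with growing ones whose Z tends to y). "Convergent implies Cauchy" is for all sequences. *)

theory Defs
  imports "HOL-Analysis.Analysis" "HOL-Combinatorics.Permutations"
begin

text \<open>A permutation of \<open>[n]\<close> is a pair \<open>(n, \<pi>)\<close>. The length has to be recorded, since \<open>\<pi>\<close> fixes
  everything outside \<open>{1..n}\<close> and so does not determine \<open>n\<close>.\<close>

type_synonym perm = "nat \<times> (nat \<Rightarrow> nat)"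

abbreviation len :: "perm \<Rightarrow> nat" where
  "len \<equiv> fst"

definition perms :: "perm set" where
  "perms = {(n, \<pi>). 1 \<le> n \<and> \<pi> permutes {1..n}}"

definition occurrences :: "perm \<Rightarrow> perm \<Rightarrow> nat" where
  "occurrences \<tau> \<pi> = card {x \<in> {1..len \<tau>} \<rightarrow>\<^sub>E {1..len \<pi>}.
     strict_mono_on {1..len \<tau>} x \<and>
     (\<forall>i\<in>{1..len \<tau>}. \<forall>j\<in>{1..len \<tau>}. snd \<pi> (x i) < snd \<pi> (x j) \<longleftrightarrow> snd \<tau> i < snd \<tau> j)}"

definition pattern_density :: "perm \<Rightarrow> perm \<Rightarrow> real" where
  "pattern_density \<tau> \<pi> =
     (if len \<tau> \<le> len \<pi> then real (occurrences \<tau> \<pi>) / real (len \<pi> choose len \<tau>) else 0)"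

definition perm_convergent :: "(nat \<Rightarrow> perm) \<Rightarrow> bool" where
  "perm_convergent \<sigma> \<longleftrightarrow> (\<forall>\<tau>\<in>perms. convergent (\<lambda>n. pattern_density \<tau> (\<sigma> n)))"

text \<open>Only the values on \<open>[0,1]\<^sup>2\<close> matter.\<close>

definition Z_perm :: "perm \<Rightarrow> real \<Rightarrow> real \<Rightarrow> real" where
  "Z_perm \<sigma> x y = (if x = 0 then y
     else min 1 (max 0 (real (len \<sigma>) * y - real (snd \<sigma> (nat \<lceil>real (len \<sigma>) * x\<rceil>)) + 1)))"

definition d_box :: "(real \<Rightarrow> real \<Rightarrow> real) \<Rightarrow> (real \<Rightarrow> real \<Rightarrow> real) \<Rightarrow> real" where
  "d_box Z1 Z2 =
     (SUP (x1, x2, y1, y2) \<in> {(x1, x2, y1, y2). 0 \<le> x1 \<and> x1 < x2 \<and> x2 \<le> 1 \<and>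
                                                0 \<le> y1 \<and> y1 < y2 \<and> y2 \<le> 1}.
        \<bar>integral {x1..x2} (\<lambda>x. Z1 x y2 - Z1 x y1) - integral {x1..x2} (\<lambda>x. Z2 x y2 - Z2 x y1)\<bar>)"

definition d_box_perm :: "perm \<Rightarrow> perm \<Rightarrow> real" where
  "d_box_perm \<sigma> \<pi> = d_box (Z_perm \<sigma>) (Z_perm \<pi>)"

definition box_Cauchy :: "(nat \<Rightarrow> perm) \<Rightarrow> bool" where
  "box_Cauchy \<sigma> \<longleftrightarrow>
     (\<forall>\<epsilon>>0. \<exists>n0. \<forall>n\<ge>n0. \<forall>m\<ge>n0. d_box_perm (\<sigma> n) (\<sigma> m) < \<epsilon>)"

text \<open>Sequences violating this mix an infinite subsequence of bounded length with one of unbounded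
  length. They are never convergent, but may be Cauchy: alternate the permutation of length 1,
  for which \<open>Z(x,y) = y\<close>, with permutations of growing length whose \<open>Z\<close> tends to the same limit.\<close>

definition lengths_bounded_or_to_infinity :: "(nat \<Rightarrow> perm) \<Rightarrow> bool" where
  "lengths_bounded_or_to_infinity \<sigma> \<longleftrightarrow>
     bdd_above (range (\<lambda>n. len (\<sigma> n))) \<or> filterlim (\<lambda>n. len (\<sigma> n)) at_top sequentially"

end

theory Submission imports Defs begin

text \<open>
  For lengths tending to infinity, both notions of convergence are equivalent to pointwise convergence
  of the empirical distribution functions \<open>G\<^sub>\<sigma>(s,t) = #{i \<le> s n. \<sigma>(i) \<le> t n} / n\<close>. These are monotone
  and Lipschitz up to \<open>O(1/n)\<close>, and \<open>\<integral>\<^sub>0\<^sup>s Z\<^sub>\<sigma>(x,t) dx = G\<^sub>\<sigma>(s,t) + O(1/n)\<close>, so pointwise convergence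
  is uniform and amounts to the Cauchy property for \<open>d\<^sub>\<box>\<close>.

  If all pattern densities converge, then so do the moments \<open>n\<^sup>-\<^sup>1 \<Sum>\<^sub>i (i/n)\<^sup>a (\<sigma>(i)/n)\<^sup>b\<close>: up to \<open>O(1/n)\<close> such a
  moment is the probability of an event about the relative order of \<open>a + b + 1\<close> independent random
  points of \<open>\<sigma>\<close>, hence a linear combination of pattern densities. Approximating indicators of
  half-lines by polynomials (Weierstrass) gives convergence of \<open>G\<^sub>\<sigma>\<close>. Conversely, divide the unit
  square into \<open>m\<^sup>2\<close> equal cells. Unless two of \<open>k\<close> random points share a row or a column of cells,
  which has probability \<open>O(1/m + 1/n)\<close>, their pattern is determined by their cells, so the density of
  a pattern is within \<open>O(1/m + 1/n)\<close> of a polynomial in the cell masses, which are differences of values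
  of \<open>G\<^sub>\<sigma>\<close>.

  For bounded lengths both notions mean that the sequence is eventually constant. Finally, the densities
  of all patterns of length \<open>k\<close> sum to 1 for permutations of length at least \<open>k\<close> and to 0 for shorter ones,
  so a convergent sequence has bounded lengths or lengths tending to infinity.
\<close>

section \<open>The box distance and distribution functions\<close>

text \<open>The antiderivative in the first variable turns every box integral into an alternating
  sum of four values, so that \<open>d_box\<close> is controlled by the uniform distance of these
  functions and conversely.\<close>

definition box_cdf :: "perm \<Rightarrow> real \<Rightarrow> real \<Rightarrow> real" where
  "box_cdf \<sigma> x y = integral {0..x} (\<lambda>t. Z_perm \<sigma> t y)"

text \<open>\<open>Z_perm\<close> away from \<open>x = 0\<close> depends on \<open>x\<close> only
  through the column index; naming the value per column exhibits \<open>Z_perm\<close> as a step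
  function in \<open>x\<close>.\<close>

definition Z_row :: "perm \<Rightarrow> real \<Rightarrow> nat \<Rightarrow> real" where
  "Z_row \<sigma> y i = min 1 (max 0 (real (len \<sigma>) * y - real (snd \<sigma> i) + 1))"

definition perm_cdf :: "perm \<Rightarrow> real \<Rightarrow> real \<Rightarrow> real" where
  "perm_cdf \<sigma> s t =
     real (card {i \<in> {1..len \<sigma>}. real i \<le> s * real (len \<sigma>) \<and> real (snd \<sigma> i) \<le> t * real (len \<sigma>)})
       / real (len \<sigma>)"

lemma permsD:
  assumes "\<sigma> \<in> perms"
  shows "1 \<le> len \<sigma>" "snd \<sigma> permutes {1..len \<sigma>}"
  using assms by (auto simp: perms_def)

text \<open>Inside the \<open>i\<close>-th cell the ceiling is constantly \<open>i\<close>, except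
  possibly at the left endpoint, which is a null set. Arbitrary subintervals of the cell are allowed
  because \<open>perm_eq_if_d_box_0\<close> integrates over one short interval for two different
  lengths.\<close>

lemma has_integral_ceiling_cell:
  fixes h :: "nat \<Rightarrow> real"
  assumes "1 \<le> n" "1 \<le> i" "(real i - 1) / real n \<le> a" "a \<le> b" "b \<le> real i / real n"
  shows "((\<lambda>x. h (nat \<lceil>real n * x\<rceil>)) has_integral (b - a) * h i) {a..b}"
proof (rule has_integral_spike_finite[where S = "{a}" and f = "\<lambda>_. h i"])
  fix x assume x: "x \<in> {a..b} - {a}"
  have n: "0 < real n" using assms by simp
  have "real i - 1 \<le> real n * a" using assms(3) n by (simp only: pos_divide_le_eq mult.commute)
  also have "\<dots> < real n * x" using x n by (intro mult_strict_left_mono) auto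
  finally have "real i - 1 < real n * x" .
  moreover have "real n * x \<le> real n * b" using x n by (intro mult_left_mono) auto
  moreover have "real n * b \<le> real i" using assms(5) n by (simp only: pos_le_divide_eq mult.commute)
  ultimately have "\<lceil>real n * x\<rceil> = int i" by (simp add: ceiling_eq_iff)
  then show "h (nat \<lceil>real n * x\<rceil>) = h i" by simp
qed (use has_integral_const_real[of "h i" a b] assms in auto)

lemma has_integral_ceiling_prefix:
  fixes h :: "nat \<Rightarrow> real"
  assumes "1 \<le> n"
  shows "((\<lambda>x. h (nat \<lceil>real n * x\<rceil>)) has_integral (\<Sum>i=1..j. h i) / real n) {0..real j / real n}"
proof (induction j)
  case 0
  show ?case by (simp add: has_integral_refl)
next
  case (Suc j)
  have "((\<lambda>x. h (nat \<lceil>real n * x\<rceil>)) has_integral (real (Suc j) / real n - real j / real n) * h (Suc j))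
    {real j / real n..real (Suc j) / real n}"
    by (rule has_integral_ceiling_cell) (use assms in \<open>auto simp: field_simps\<close>)
  from has_integral_combine[OF _ _ Suc this] assms
  show ?case by (simp add: field_simps)
qed

lemma Z_perm_row: "x \<noteq> 0 \<Longrightarrow> Z_perm \<sigma> x y = Z_row \<sigma> y (nat \<lceil>real (len \<sigma>) * x\<rceil>)"
  by (simp add: Z_perm_def Z_row_def)

text \<open>The special value at \<open>x = 0\<close> sits on a null set.\<close>

lemma Z_perm_has_integral_iff:
  "((\<lambda>t. Z_perm \<sigma> t y) has_integral c) S \<longleftrightarrow>
   ((\<lambda>t. Z_row \<sigma> y (nat \<lceil>real (len \<sigma>) * t\<rceil>)) has_integral c) S"
  by (rule has_integral_spike_finite_eq[of "{0}"]) (auto simp: Z_perm_row)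

lemma Z_perm_bounds: "0 \<le> y \<Longrightarrow> y \<le> 1 \<Longrightarrow> 0 \<le> Z_perm \<sigma> x y \<and> Z_perm \<sigma> x y \<le> 1"
  by (auto simp: Z_perm_def)

lemma Z_perm_integrable:
  assumes "1 \<le> len \<sigma>" "0 \<le> a" "b \<le> 1"
  shows "(\<lambda>t. Z_perm \<sigma> t y) integrable_on {a..b}"
proof -
  have "(\<lambda>t. Z_perm \<sigma> t y) integrable_on {0..1}"
    using has_integral_ceiling_prefix[OF assms(1), of "Z_row \<sigma> y" "len \<sigma>"] assms
    unfolding Z_perm_has_integral_iff[symmetric] by (auto simp: integrable_on_def)
  then show ?thesis by (rule integrable_on_subinterval) (use assms in auto)
qed

lemma box_cdf_diff:
  assumes "1 \<le> len \<sigma>" "0 \<le> a" "a \<le> b" "b \<le> 1"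
  shows "integral {a..b} (\<lambda>t. Z_perm \<sigma> t y) = box_cdf \<sigma> b y - box_cdf \<sigma> a y"
  using Henstock_Kurzweil_Integration.integral_combine
    [OF assms(2,3) Z_perm_integrable[OF assms(1) order_refl assms(4)], of y]
  by (simp add: box_cdf_def)

lemma box_cdf_Lipschitz:
  assumes "1 \<le> len \<sigma>" "0 \<le> a" "a \<le> b" "b \<le> 1" "0 \<le> y" "y \<le> 1"
  shows "0 \<le> box_cdf \<sigma> b y - box_cdf \<sigma> a y" "box_cdf \<sigma> b y - box_cdf \<sigma> a y \<le> b - a"
proof -
  have i: "(\<lambda>t. Z_perm \<sigma> t y) integrable_on {a..b}" by (rule Z_perm_integrable) (use assms in auto)
  show "0 \<le> box_cdf \<sigma> b y - box_cdf \<sigma> a y"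
    using integral_nonneg[OF i] Z_perm_bounds[OF assms(5,6)] box_cdf_diff[OF assms(1-4)] by metis
  have "integral {a..b} (\<lambda>t. Z_perm \<sigma> t y) \<le> integral {a..b} (\<lambda>t. 1)"
    by (rule integral_le[OF i]) (use Z_perm_bounds[OF assms(5,6)] in auto)
  then show "box_cdf \<sigma> b y - box_cdf \<sigma> a y \<le> b - a"
    using box_cdf_diff[OF assms(1-4)] assms by simp
qed

lemma box_cdf_0: "box_cdf \<sigma> 0 y = 0"
  by (simp add: box_cdf_def)

lemma box_cdf_bounds:
  assumes "1 \<le> len \<sigma>" "0 \<le> x" "x \<le> 1" "0 \<le> y" "y \<le> 1"
  shows "0 \<le> box_cdf \<sigma> x y" "box_cdf \<sigma> x y \<le> 1"
  using box_cdf_Lipschitz[OF assms(1) order_refl assms(2-5)] assms by (auto simp: box_cdf_0)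

lemma box_cdf_cell:
  assumes "1 \<le> len \<sigma>" "1 \<le> i" "i \<le> len \<sigma>" "(real i - 1) / real (len \<sigma>) \<le> a" "a \<le> b" "b \<le> real i / real (len \<sigma>)"
  shows "box_cdf \<sigma> b y - box_cdf \<sigma> a y = (b - a) * Z_row \<sigma> y i"
proof -
  have "0 \<le> (real i - 1) / real (len \<sigma>)" "real i / real (len \<sigma>) \<le> 1" using assms by auto
  then have "0 \<le> a" "b \<le> 1" using assms by linarith+
  then show ?thesis
    using has_integral_ceiling_cell[OF assms(1,2,4-6), of "Z_row \<sigma> y"] box_cdf_diff[OF assms(1) _ assms(5), of y]
    unfolding Z_perm_has_integral_iff[symmetric] by (simp add: integral_unique)
qed

lemma box_cdf_prefix:
  assumes "1 \<le> len \<sigma>"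
  shows "box_cdf \<sigma> (real j / real (len \<sigma>)) y = (\<Sum>i=1..j. Z_row \<sigma> y i) / real (len \<sigma>)"
  using has_integral_ceiling_prefix[OF assms, of "Z_row \<sigma> y" j]
  unfolding Z_perm_has_integral_iff[symmetric] box_cdf_def by (rule integral_unique)

text \<open>At height 0 every ramp is still at 0, since all values of the permutation are at least
  1. Hence the integral over a box with corner at the origin is a single value of
  \<open>box_cdf\<close>.\<close>

lemma box_cdf_bottom:
  assumes "\<sigma> \<in> perms" "0 \<le> x" "x \<le> 1"
  shows "box_cdf \<sigma> x 0 = 0"
proof -
  note p = permsD[OF assms(1)]
  have "Z_row \<sigma> 0 i = 0" if "1 \<le> i" "i \<le> len \<sigma>" for i
    using permutes_in_image[OF p(2), of i] that by (auto simp: Z_row_def)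
  then have "box_cdf \<sigma> 1 0 = 0"
    using box_cdf_prefix[OF p(1), of "len \<sigma>" 0] p by simp
  then show ?thesis
    using box_cdf_Lipschitz(1)[OF p(1) assms(2,3), of 0] box_cdf_bounds(1)[OF p(1) assms(2,3), of 0] by simp
qed

lemma box_integral:
  assumes "\<sigma> \<in> perms" "0 \<le> x1" "x1 < x2" "x2 \<le> 1"
  shows "integral {x1..x2} (\<lambda>x. Z_perm \<sigma> x y2 - Z_perm \<sigma> x y1) =
    (box_cdf \<sigma> x2 y2 - box_cdf \<sigma> x1 y2) - (box_cdf \<sigma> x2 y1 - box_cdf \<sigma> x1 y1)"
  using assms permsD(1)[OF assms(1)]
  by (simp add: Henstock_Kurzweil_Integration.integral_diff Z_perm_integrable box_cdf_diff)

text \<open>One error \<open>e\<close> for each of the four corners of a box.\<close>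

lemma d_box_perm_le:
  assumes "\<sigma> \<in> perms" "\<pi> \<in> perms"
    and "\<And>x y. 0 \<le> x \<Longrightarrow> x \<le> 1 \<Longrightarrow> 0 \<le> y \<Longrightarrow> y \<le> 1 \<Longrightarrow> \<bar>box_cdf \<sigma> x y - box_cdf \<pi> x y\<bar> \<le> e"
  shows "d_box_perm \<sigma> \<pi> \<le> 4 * e"
  unfolding d_box_perm_def d_box_def
proof (rule cSUP_least, goal_cases)
  case 1
  have "(0, 1, 0, 1) \<in> {(x1::real, x2::real, y1::real, y2::real).
    0 \<le> x1 \<and> x1 < x2 \<and> x2 \<le> 1 \<and> 0 \<le> y1 \<and> y1 < y2 \<and> y2 \<le> 1}" by simp
  then show ?case by blast
next
  case (2 z)
  then obtain x1 x2 y1 y2 where z: "z = (x1, x2, y1, y2)" "0 \<le> x1" "x1 < x2" "x2 \<le> 1"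
    "0 \<le> y1" "y1 < y2" "y2 \<le> 1" by auto
  show ?case
    using assms(3)[of x1 y1] assms(3)[of x1 y2] assms(3)[of x2 y1] assms(3)[of x2 y2] z
    by (simp add: box_integral assms(1,2))
qed

text \<open>The box with opposite corners at the origin and at \<open>(x, y)\<close> witnesses the
  bound.\<close>

lemma box_cdf_diff_le_d_box_perm:
  assumes "\<sigma> \<in> perms" "\<pi> \<in> perms" "0 \<le> x" "x \<le> 1" "0 \<le> y" "y \<le> 1"
  shows "\<bar>box_cdf \<sigma> x y - box_cdf \<pi> x y\<bar> \<le> d_box_perm \<sigma> \<pi>"
proof -
  let ?S = "{(x1::real, x2::real, y1::real, y2::real).
    0 \<le> x1 \<and> x1 < x2 \<and> x2 \<le> 1 \<and> 0 \<le> y1 \<and> y1 < y2 \<and> y2 \<le> 1}"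
  let ?f = "\<lambda>(x1, x2, y1, y2). \<bar>integral {x1..x2} (\<lambda>x. Z_perm \<sigma> x y2 - Z_perm \<sigma> x y1)
    - integral {x1..x2} (\<lambda>x. Z_perm \<pi> x y2 - Z_perm \<pi> x y1)\<bar>"
  \<comment> \<open>The supremum of a set of reals dominates its members only if the set is bounded;
    8 accounts for four corners of two functions with values in [0,1].\<close>
  have bdd: "bdd_above (?f ` ?S)"
  proof (rule bdd_aboveI2)
    fix z assume "z \<in> ?S"
    then obtain x1 x2 y1 y2 where z: "z = (x1, x2, y1, y2)" "0 \<le> x1" "x1 < x2" "x2 \<le> 1"
      "0 \<le> y1" "y1 < y2" "y2 \<le> 1" by auto
    have b: "0 \<le> box_cdf \<rho> u v \<and> box_cdf \<rho> u v \<le> 1" if "\<rho> \<in> perms" "u \<in> {x1,x2}" "v \<in> {y1,y2}" for \<rho> u v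
      using box_cdf_bounds[OF permsD(1)[OF that(1)], of u v] that z by auto
    show "?f z \<le> 8"
      using b[OF assms(1), of x1 y1] b[OF assms(1), of x1 y2] b[OF assms(1), of x2 y1] b[OF assms(1), of x2 y2]
        b[OF assms(2), of x1 y1] b[OF assms(2), of x1 y2] b[OF assms(2), of x2 y1] b[OF assms(2), of x2 y2] z
      by (simp add: box_integral assms(1,2) abs_le_iff)
  qed
  have up: "?f z \<le> d_box_perm \<sigma> \<pi>" if "z \<in> ?S" for z
    unfolding d_box_perm_def d_box_def by (rule cSUP_upper[OF that bdd])
  show ?thesis
  \<comment> \<open>Degenerate boxes are excluded from the supremum, but on these two sides both
    functions vanish.\<close>
  proof (cases "x = 0 \<or> y = 0")
    case True
    have "0 \<le> d_box_perm \<sigma> \<pi>" using up[of "(0,1,0,1)"] by auto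
    with True show ?thesis using assms by (auto simp: box_cdf_0 box_cdf_bottom)
  next
    case False
    then show ?thesis using up[of "(0,x,0,y)"] assms
      by (auto simp: box_integral box_cdf_0 box_cdf_bottom)
  qed
qed

text \<open>One \<open>1/n\<close> comes from rounding \<open>s\<close> down to a multiple of
  \<open>1/n\<close>, the other from the single column whose ramp may be strictly between 0 and 1 at
  height \<open>t\<close>.\<close>

lemma box_cdf_approx:
  assumes "\<sigma> \<in> perms" "0 \<le> s" "s \<le> 1" "0 \<le> t" "t \<le> 1"
  shows "\<bar>box_cdf \<sigma> s t - perm_cdf \<sigma> s t\<bar> \<le> 2 / real (len \<sigma>)"
proof -
  note p = permsD[OF assms(1)]
  let ?n = "len \<sigma>"
  define j where "j = nat \<lfloor>s * real ?n\<rfloor>"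
  have j: "real j \<le> s * real ?n" "s * real ?n < real j + 1"
    using assms by (auto simp: j_def)
  have jn: "j \<le> ?n" using j(1) assms mult_right_mono[of s 1 "real ?n"] by (simp add: order_trans)
  have le_iff: "real i \<le> s * real ?n \<longleftrightarrow> i \<le> j" for i
    using j by linarith
  have js: "real j / real ?n \<le> s" "s - real j / real ?n \<le> 1 / real ?n"
  proof -
    have n: "0 < real ?n" using p by simp
    show "real j / real ?n \<le> s" using j(1) n by (simp only: pos_divide_le_eq)
    have "s \<le> (real j + 1) / real ?n" using j(2) n by (simp only: pos_le_divide_eq less_imp_le)
    then show "s - real j / real ?n \<le> 1 / real ?n" by (simp add: add_divide_distrib)
  qed
  have 1: "\<bar>box_cdf \<sigma> s t - box_cdf \<sigma> (real j / real ?n) t\<bar> \<le> 1 / real ?n"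
    using box_cdf_Lipschitz[OF p(1) _ js(1) assms(3-5)] js(2) by simp
  define g where "g i = (if real (snd \<sigma> i) \<le> t * real ?n then 1 else 0 :: real)" for i
  have "{i \<in> {1..?n}. real i \<le> s * real ?n \<and> real (snd \<sigma> i) \<le> t * real ?n}
    = {i \<in> {1..j}. real (snd \<sigma> i) \<le> t * real ?n}"
    using jn le_iff by auto
  then have cdf: "perm_cdf \<sigma> s t = (\<Sum>i=1..j. g i) / real ?n"
    by (simp add: perm_cdf_def g_def sum.If_cases Int_def)
  \<comment> \<open>Only a point of value \<open>r\<close> can have height \<open>t\<close> on its
    ramp; for every other point the ramp value already equals the indicator
    \<open>g\<close>.\<close>
  define r where "r = nat \<lceil>t * real ?n\<rceil>"
  have gd: "\<bar>Z_row \<sigma> t i - g i\<bar> \<le> (if i = inv (snd \<sigma>) r then 1 else 0)" for i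
  proof (cases "snd \<sigma> i = r")
    case True
    then have "i = inv (snd \<sigma>) r" using p(2) by (metis permutes_inverses(2))
    then show ?thesis by (auto simp: Z_row_def g_def)
  next
    case False
    then have "real (snd \<sigma> i) \<le> t * real ?n \<or> real (snd \<sigma> i) \<ge> t * real ?n + 1"
      unfolding r_def using assms by linarith
    then show ?thesis by (auto simp: Z_row_def g_def mult.commute)
  qed
  have "\<bar>(\<Sum>i=1..j. Z_row \<sigma> t i) - (\<Sum>i=1..j. g i)\<bar> \<le> (\<Sum>i=1..j. \<bar>Z_row \<sigma> t i - g i\<bar>)"
    unfolding sum_subtractf[symmetric] by (rule sum_abs)
  also have "\<dots> \<le> (\<Sum>i=1..j. if i = inv (snd \<sigma>) r then 1 else 0)"
    by (intro sum_mono gd)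
  also have "\<dots> \<le> 1" by (simp add: sum.delta)
  finally have "\<bar>box_cdf \<sigma> (real j / real ?n) t - perm_cdf \<sigma> s t\<bar> \<le> 1 / real ?n"
    using p by (simp add: box_cdf_prefix cdf diff_divide_distrib[symmetric] divide_right_mono)
  with 1 show ?thesis by (simp add: field_simps)
qed

text \<open>Over the first column \<open>Z\<close> rises from 0 to 1 as \<open>y\<close> runs from
  \<open>(snd \<sigma> 1 - 1) / n\<close> to \<open>snd \<sigma> 1 / n\<close>. The two ends of this
  ramp are determined by \<open>box_cdf\<close>, and their distance \<open>1/n\<close> reveals the
  length. With equal lengths the columns can be compared one by one.\<close>

lemma perm_eq_if_d_box_0:
  assumes "\<sigma> \<in> perms" "\<pi> \<in> perms" "d_box_perm \<sigma> \<pi> \<le> 0"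
  shows "\<sigma> = \<pi>"
proof -
  note p = permsD[OF assms(1)] permsD[OF assms(2)]
  have eq: "box_cdf \<sigma> x y = box_cdf \<pi> x y" if "0 \<le> x" "x \<le> 1" "0 \<le> y" "y \<le> 1" for x y
    using box_cdf_diff_le_d_box_perm[OF assms(1,2) that] assms(3) by simp
  \<comment> \<open>The interval from 0 to \<open>a\<close> lies in the first column of both
    permutations.\<close>
  define a where "a = 1 / real (max (len \<sigma>) (len \<pi>))"
  have a: "0 < a" "a \<le> 1" "a \<le> 1 / real (len \<sigma>)" "a \<le> 1 / real (len \<pi>)"
    using p(1,3) by (auto simp: a_def field_simps)
  have first: "box_cdf \<rho> a y = a * Z_row \<rho> y 1" if "\<rho> = \<sigma> \<or> \<rho> = \<pi>" for \<rho> y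
    using box_cdf_cell[of \<rho> 1 0 a y] that p(1,3) a by (auto simp: box_cdf_0)
  have row1: "Z_row \<sigma> y 1 = Z_row \<pi> y 1" if "0 \<le> y" "y \<le> 1" for y
    using eq[of a y] that a first by simp
  have rng: "1 \<le> snd \<rho> i \<and> snd \<rho> i \<le> len \<rho>" if "\<rho> = \<sigma> \<or> \<rho> = \<pi>" "1 \<le> i" "i \<le> len \<rho>" for \<rho> i
    using permutes_in_image[OF p(2), of i] permutes_in_image[OF p(4), of i] that by auto
  \<comment> \<open>Where the ramp of \<open>\<rho>\<close> has just reached 1, the other one has
    ended too; where it is still at 0, the other one has not begun. Exchanging the roles gives
    equality of both ends.\<close>
  have le1: "real (snd \<rho>' 1) / real (len \<rho>') \<le> real (snd \<rho> 1) / real (len \<rho>) \<and>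
      (real (snd \<rho> 1) - 1) / real (len \<rho>) \<le> (real (snd \<rho>' 1) - 1) / real (len \<rho>')"
    if c: "\<rho> = \<sigma> \<and> \<rho>' = \<pi> \<or> \<rho> = \<pi> \<and> \<rho>' = \<sigma>" for \<rho> \<rho>'
  proof -
    have l: "1 \<le> len \<rho>" "1 \<le> len \<rho>'" using c p by auto
    have r: "1 \<le> snd \<rho> 1" "snd \<rho> 1 \<le> len \<rho>" using rng[of \<rho> 1] c l by auto
    have e: "Z_row \<rho> y 1 = Z_row \<rho>' y 1" if "0 \<le> y" "y \<le> 1" for y
      using row1[OF that] c by auto
    have "Z_row \<rho> (real (snd \<rho> 1) / real (len \<rho>)) 1 = 1" using l by (simp add: Z_row_def)
    then have "Z_row \<rho>' (real (snd \<rho> 1) / real (len \<rho>)) 1 = 1" using e l r by simp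
    then have A: "real (len \<rho>') * (real (snd \<rho> 1) / real (len \<rho>)) \<ge> real (snd \<rho>' 1)"
      by (simp add: Z_row_def min_def max_def split: if_splits)
    have "Z_row \<rho> ((real (snd \<rho> 1) - 1) / real (len \<rho>)) 1 = 0" using l by (simp add: Z_row_def)
    then have "Z_row \<rho>' ((real (snd \<rho> 1) - 1) / real (len \<rho>)) 1 = 0" using e l r by simp
    then have B: "real (len \<rho>') * ((real (snd \<rho> 1) - 1) / real (len \<rho>)) \<le> real (snd \<rho>' 1) - 1"
      by (simp add: Z_row_def min_def max_def split: if_splits)
    have "0 < real (len \<rho>')" using l by simp
    then show ?thesis using A B by (metis pos_divide_le_eq pos_le_divide_eq mult.commute)
  qed
  have "real (snd \<sigma> 1) / real (len \<sigma>) = real (snd \<pi> 1) / real (len \<pi>)"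
    "(real (snd \<sigma> 1) - 1) / real (len \<sigma>) = (real (snd \<pi> 1) - 1) / real (len \<pi>)"
    using le1[of \<sigma> \<pi>] le1[of \<pi> \<sigma>] by auto
  then have "1 / real (len \<sigma>) = 1 / real (len \<pi>)" by (simp add: diff_divide_distrib)
  then have n: "len \<sigma> = len \<pi>" by simp
  have row: "Z_row \<sigma> y i = Z_row \<pi> y i" if i: "1 \<le> i" "i \<le> len \<sigma>" and y: "0 \<le> y" "y \<le> 1" for y i
  proof -
    have "(1 / real (len \<rho>)) * Z_row \<rho> y i
        = box_cdf \<rho> (real i / real (len \<rho>)) y - box_cdf \<rho> ((real i - 1) / real (len \<rho>)) y"
      if "\<rho> = \<sigma> \<or> \<rho> = \<pi>" for \<rho>
      using box_cdf_cell[of \<rho> i "(real i - 1) / real (len \<rho>)" "real i / real (len \<rho>)" y] that p n i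
      by (auto simp: diff_divide_distrib divide_right_mono)
    from this[of \<sigma>] this[of \<pi>]
    have "(1 / real (len \<pi>)) * Z_row \<sigma> y i = (1 / real (len \<pi>)) * Z_row \<pi> y i"
      using eq[of "real i / real (len \<sigma>)" y] eq[of "(real i - 1) / real (len \<sigma>)" y] i y n p(1) by simp
    moreover have "1 / real (len \<pi>) \<noteq> 0" using p(3) by simp
    ultimately show ?thesis by (simp only: mult_cancel_left) simp
  qed
  \<comment> \<open>The upper end of the ramp in column \<open>i\<close> gives one inequality;
    exchanging the roles gives the other.\<close>
  have le: "snd \<rho>' i \<le> snd \<rho> i"
    if c: "\<rho> = \<sigma> \<and> \<rho>' = \<pi> \<or> \<rho> = \<pi> \<and> \<rho>' = \<sigma>" and i: "1 \<le> i" "i \<le> len \<sigma>" for \<rho> \<rho>' i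
  proof -
    have l: "1 \<le> len \<rho>" "len \<rho>' = len \<rho>" using c p n by auto
    have r: "1 \<le> snd \<rho> i" "snd \<rho> i \<le> len \<rho>" using rng[of \<rho> i] c i n by auto
    have "Z_row \<rho> (real (snd \<rho> i) / real (len \<rho>)) i = 1" using l by (simp add: Z_row_def)
    moreover have "Z_row \<rho> (real (snd \<rho> i) / real (len \<rho>)) i = Z_row \<rho>' (real (snd \<rho> i) / real (len \<rho>)) i"
      using row[of i "real (snd \<rho> i) / real (len \<rho>)"] c i l r by auto
    ultimately show ?thesis
      using l by (simp add: Z_row_def min_def max_def split: if_splits)
  qed
  have "snd \<sigma> i = snd \<pi> i" for i
  proof (cases "i \<in> {1..len \<sigma>}")
    case True
    then show ?thesis using le[of \<sigma> \<pi> i] le[of \<pi> \<sigma> i] by auto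
  next
    case False
    then show ?thesis using p n by (simp add: permutes_not_in)
  qed
  then show ?thesis using n by (simp add: prod_eq_iff fun_eq_iff)
qed

section \<open>Monotonicity and near-Lipschitz continuity of the empirical distribution
  functions\<close>

lemma card_nat_interval_le:
  fixes a b :: real
  assumes "a \<le> b"
  shows "real (card {i::nat. a < real i \<and> real i \<le> b}) \<le> b - a + 1"
proof -
  have "int ` {i::nat. a < real i \<and> real i \<le> b} \<subseteq> {\<lfloor>a\<rfloor> + 1..\<lfloor>b\<rfloor>}"
    by (auto simp: le_floor_iff) linarith
  from card_mono[OF _ this] have "card {i::nat. a < real i \<and> real i \<le> b} \<le> nat (\<lfloor>b\<rfloor> - \<lfloor>a\<rfloor>)"
    by (simp add: card_image)
  moreover have "\<lfloor>a\<rfloor> \<le> \<lfloor>b\<rfloor>" using assms by (rule floor_mono)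
  ultimately show ?thesis by linarith
qed

lemma finite_nat_interval: "finite {i::nat. a < real i \<and> real i \<le> (b::real)}"
  by (rule finite_subset[of _ "{..nat \<lfloor>b\<rfloor>}"]) (auto simp: le_nat_floor)

lemma perm_cdf_mono:
  assumes "s \<le> s'" "t \<le> t'"
  shows "perm_cdf \<sigma> s t \<le> perm_cdf \<sigma> s' t'"
proof -
  have "s * real (len \<sigma>) \<le> s' * real (len \<sigma>)" "t * real (len \<sigma>) \<le> t' * real (len \<sigma>)"
    using assms by (auto intro: mult_right_mono)
  then have "card {i \<in> {1..len \<sigma>}. real i \<le> s * real (len \<sigma>) \<and> real (snd \<sigma> i) \<le> t * real (len \<sigma>)}
    \<le> card {i \<in> {1..len \<sigma>}. real i \<le> s' * real (len \<sigma>) \<and> real (snd \<sigma> i) \<le> t' * real (len \<sigma>)}"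
    by (intro card_mono Collect_mono) (auto simp del: mult_le_cancel_right)
  then show ?thesis by (simp add: perm_cdf_def divide_right_mono)
qed

text \<open>The additional points lie in a vertical or in a horizontal strip. A strip of width
  \<open>w\<close> has at most \<open>w n + 1\<close> points, in the horizontal case because the
  permutation is a bijection.\<close>

lemma perm_cdf_increment:
  assumes "\<sigma> \<in> perms" "s \<le> s'" "t \<le> t'"
  shows "perm_cdf \<sigma> s' t' \<le> perm_cdf \<sigma> s t + (s' - s) + (t' - t) + 2 / real (len \<sigma>)"
proof -
  note p = permsD[OF assms(1)]
  let ?n = "real (len \<sigma>)"
  let ?A = "\<lambda>s t. {i \<in> {1..len \<sigma>}. real i \<le> s * ?n \<and> real (snd \<sigma> i) \<le> t * ?n}"
  let ?B = "{i::nat. s * ?n < real i \<and> real i \<le> s' * ?n}"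
  let ?C = "{i. t * ?n < real (snd \<sigma> i) \<and> real (snd \<sigma> i) \<le> t' * ?n}"
  have n: "0 < ?n" using p by simp
  have le: "s * ?n \<le> s' * ?n" "t * ?n \<le> t' * ?n" using assms by (auto intro: mult_right_mono)
  have "?C = snd \<sigma> -` {i::nat. t * ?n < real i \<and> real i \<le> t' * ?n}" by auto
  then have C: "card ?C = card {i::nat. t * ?n < real i \<and> real i \<le> t' * ?n}" "finite ?C"
    using card_vimage_inj[of "snd \<sigma>" "{i::nat. t * ?n < real i \<and> real i \<le> t' * ?n}"]
      finite_vimageI[OF finite_nat_interval, of "snd \<sigma>" "t * ?n" "t' * ?n"]
      permutes_inj[OF p(2)] permutes_surj[OF p(2)] by simp_all
  have "?A s' t' \<subseteq> ?A s t \<union> ?B \<union> ?C" by auto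
  then have "card (?A s' t') \<le> card (?A s t \<union> ?B \<union> ?C)"
    using C(2) finite_nat_interval by (intro card_mono) auto
  also have "\<dots> \<le> card (?A s t) + card ?B + card ?C"
    by (meson card_Un_le add_le_mono1 order_trans)
  finally have "real (card (?A s' t')) \<le> real (card (?A s t)) + real (card ?B) + real (card ?C)"
    by linarith
  also have "\<dots> \<le> real (card (?A s t)) + (s' * ?n - s * ?n + 1) + (t' * ?n - t * ?n + 1)"
    using card_nat_interval_le[OF le(1)] card_nat_interval_le[OF le(2)] C(1) by linarith
  finally have "real (card (?A s' t')) / ?n
    \<le> (real (card (?A s t)) + (s' * ?n - s * ?n + 1) + (t' * ?n - t * ?n + 1)) / ?n"
    by (rule divide_right_mono) simp
  also have "\<dots> = real (card (?A s t)) / ?n + (s' - s) + (t' - t) + 2 / ?n"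
    using n by (simp add: field_simps)
  finally show ?thesis by (simp add: perm_cdf_def)
qed

section \<open>The Cauchy property and pointwise convergence of distribution functions, for lengths
  tending to infinity\<close>

lemma eventually_len_ge:
  assumes "filterlim (\<lambda>n. len (\<sigma> n)) at_top sequentially"
  shows "eventually (\<lambda>n. N \<le> len (\<sigma> n)) sequentially"
  using assms by (simp add: filterlim_at_top)

lemma inverse_len_tendsto_0:
  assumes "filterlim (\<lambda>n. len (\<sigma> n)) at_top sequentially"
  shows "(\<lambda>n. c / real (len (\<sigma> n))) \<longlonglongrightarrow> 0"
  by (intro tendsto_divide_0[OF tendsto_const] filterlim_at_top_imp_at_infinity
      filterlim_compose[OF filterlim_real_sequentially assms])

lemma perm_cdf_convergent_if_box_Cauchy:
  assumes "\<And>n. \<sigma> n \<in> perms" "filterlim (\<lambda>n. len (\<sigma> n)) at_top sequentially" "box_Cauchy \<sigma>"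
    and st: "0 \<le> s" "s \<le> 1" "0 \<le> t" "t \<le> 1"
  shows "convergent (\<lambda>n. perm_cdf (\<sigma> n) s t)"
proof -
  have "Cauchy (\<lambda>n. perm_cdf (\<sigma> n) s t)"
    unfolding Cauchy_altdef2
  proof (intro allI impI)
    fix e :: real assume e: "0 < e"
    obtain n0 where n0: "\<And>n m. n \<ge> n0 \<Longrightarrow> m \<ge> n0 \<Longrightarrow> d_box_perm (\<sigma> n) (\<sigma> m) < e / 3"
      using assms(3) e unfolding box_Cauchy_def by (metis divide_pos_pos zero_less_numeral)
    have "eventually (\<lambda>n. 2 / real (len (\<sigma> n)) < e / 3) sequentially"
      using order_tendstoD(2)[OF inverse_len_tendsto_0[OF assms(2), of 2], of "e / 3"] e by simp
    then obtain n1 where n1: "\<And>n. n \<ge> n1 \<Longrightarrow> 2 / real (len (\<sigma> n)) < e / 3"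
      by (auto simp: eventually_sequentially)
    define N where "N = max n0 n1"
    have "dist (perm_cdf (\<sigma> n) s t) (perm_cdf (\<sigma> N) s t) < e" if "n \<ge> N" for n
    proof -
      have g: "n0 \<le> n" "n1 \<le> n" "n0 \<le> N" "n1 \<le> N" using that by (auto simp: N_def)
      have "\<bar>box_cdf (\<sigma> n) s t - box_cdf (\<sigma> N) s t\<bar> \<le> d_box_perm (\<sigma> n) (\<sigma> N)"
        by (rule box_cdf_diff_le_d_box_perm[OF assms(1) assms(1) st])
      then show ?thesis
        using box_cdf_approx[OF assms(1)[of n] st] box_cdf_approx[OF assms(1)[of N] st]
          n0[OF g(1,3)] n1[OF g(2)] n1[OF g(4)] unfolding dist_real_def by linarith
    qed
    then show "\<exists>N. \<forall>n\<ge>N. dist (perm_cdf (\<sigma> n) s t) (perm_cdf (\<sigma> N) s t) < e" by blast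
  qed
  then show ?thesis by (rule Cauchy_convergent)
qed

text \<open>Convergence at the finitely many points of a grid is uniform, and monotonicity with the
  increment bound carries it to all points in between.\<close>

lemma box_Cauchy_if_perm_cdf_convergent:
  assumes P: "\<And>n. \<sigma> n \<in> perms" and L: "filterlim (\<lambda>n. len (\<sigma> n)) at_top sequentially"
    and conv: "\<And>s t. 0 \<le> s \<Longrightarrow> s \<le> 1 \<Longrightarrow> 0 \<le> t \<Longrightarrow> t \<le> 1 \<Longrightarrow> convergent (\<lambda>n. perm_cdf (\<sigma> n) s t)"
  shows "box_Cauchy \<sigma>"
  unfolding box_Cauchy_def
proof (intro allI impI)
  fix \<epsilon> :: real assume "0 < \<epsilon>"
  \<comment> \<open>Passing to a grid point costs \<open>4 e\<close>: \<open>e\<close> at the grid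
    point, \<open>2 e\<close> for the mesh and \<open>e\<close> for the term \<open>2/n\<close>. Two
    such errors and two errors \<open>e\<close> from \<open>box_cdf_approx\<close> make
    \<open>10 e\<close>, and four corners make \<open>40 e\<close>, which is below
    \<open>50 e\<close>.\<close>
  define e where "e = \<epsilon> / 50"
  have e: "0 < e" using \<open>0 < \<epsilon>\<close> by (simp add: e_def)
  obtain M :: nat where M: "1 / real (Suc M) < e" using nat_approx_posE[OF e] by metis
  define m where "m = Suc M"
  have m: "0 < real m" "1 / real m < e" using M by (auto simp: m_def)
  define G where "G = {0..m} \<times> {0..m}"
  have "\<exists>l. \<forall>g\<in>G. (\<lambda>n. perm_cdf (\<sigma> n) (real (fst g) / real m) (real (snd g) / real m)) \<longlonglongrightarrow> l g"
    by (rule bchoice) (use m in \<open>auto simp: G_def intro!: conv[unfolded convergent_def]\<close>)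
  then obtain l where l: "\<And>g. g \<in> G \<Longrightarrow>
    (\<lambda>n. perm_cdf (\<sigma> n) (real (fst g) / real m) (real (snd g) / real m)) \<longlonglongrightarrow> l g" by blast
  have "eventually (\<lambda>n. \<forall>g\<in>G. dist (perm_cdf (\<sigma> n) (real (fst g) / real m) (real (snd g) / real m)) (l g) < e)
    sequentially"
  proof (rule eventually_ball_finite)
    show "finite G" by (simp add: G_def)
  qed (use tendstoD[OF l e] in blast)
  moreover have "eventually (\<lambda>n. 2 / real (len (\<sigma> n)) < e) sequentially"
    using order_tendstoD(2)[OF inverse_len_tendsto_0[OF L, of 2] e] .
  ultimately have "eventually (\<lambda>n. 2 / real (len (\<sigma> n)) < e \<and>
    (\<forall>g\<in>G. dist (perm_cdf (\<sigma> n) (real (fst g) / real m) (real (snd g) / real m)) (l g) < e)) sequentially"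
    by (simp add: eventually_conj_iff)
  then obtain n0 where n0: "\<And>n. n \<ge> n0 \<Longrightarrow> 2 / real (len (\<sigma> n)) < e"
    "\<And>n g. n \<ge> n0 \<Longrightarrow> g \<in> G \<Longrightarrow>
      \<bar>perm_cdf (\<sigma> n) (real (fst g) / real m) (real (snd g) / real m) - l g\<bar> < e"
    unfolding eventually_sequentially dist_real_def by blast
  have "d_box_perm (\<sigma> n) (\<sigma> k) < \<epsilon>" if nk: "n \<ge> n0" "k \<ge> n0" for n k
  proof -
    have "\<bar>box_cdf (\<sigma> n) x y - box_cdf (\<sigma> k) x y\<bar> \<le> 10 * e"
      if xy: "0 \<le> x" "x \<le> 1" "0 \<le> y" "y \<le> 1" for x y
    proof -
      define up where "up z = nat \<lceil>z * real m\<rceil>" for z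
      have up: "up z \<in> {0..m} \<and> z \<le> real (up z) / real m \<and> real (up z) / real m - z \<le> 1 / real m"
        if "0 \<le> z" "z \<le> 1" for z
      proof -
        have "z * real m \<le> real m" using that mult_right_mono[of z 1 "real m"] by simp
        then have "up z \<le> m" by (simp add: up_def nat_le_iff ceiling_le_iff)
        have b: "z * real m \<le> real (up z)" "real (up z) \<le> z * real m + 1"
          using that m by (auto simp: up_def intro: of_nat_ceiling)
        have "z \<le> real (up z) / real m" using b(1) m by (simp only: pos_le_divide_eq)
        moreover have "real (up z) / real m \<le> z + 1 / real m"
          using divide_right_mono[OF b(2), of "real m"] m by (simp add: add_divide_distrib)
        ultimately show ?thesis using \<open>up z \<le> m\<close> by simp
      qed
      define g where "g = (up x, up y)"
      have g: "g \<in> G" using up xy by (auto simp: g_def G_def)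
      have near: "\<bar>perm_cdf (\<sigma> j) x y - l g\<bar> < 4 * e" if "j \<ge> n0" for j
      proof -
        let ?x = "real (up x) / real m" and ?y = "real (up y) / real m"
        have u: "x \<le> ?x" "?x - x \<le> 1 / real m" "y \<le> ?y" "?y - y \<le> 1 / real m"
          using up xy by auto
        have "\<bar>perm_cdf (\<sigma> j) ?x ?y - l g\<bar> < e" using n0(2)[OF that g] by (simp add: g_def)
        then show ?thesis
          using n0(1)[OF that] m(2) u perm_cdf_mono[OF u(1,3), of "\<sigma> j"]
            perm_cdf_increment[OF P[of j] u(1,3)] by linarith
      qed
      have "\<bar>box_cdf (\<sigma> j) x y - perm_cdf (\<sigma> j) x y\<bar> < e" if "j \<ge> n0" for j
        using box_cdf_approx[OF P[of j] xy] n0(1)[OF that] by simp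
      from this[OF nk(1)] this[OF nk(2)] near[OF nk(1)] near[OF nk(2)]
      show ?thesis using e by linarith
    qed
    then have "d_box_perm (\<sigma> n) (\<sigma> k) \<le> 4 * (10 * e)"
      by (intro d_box_perm_le P) auto
    then show ?thesis using \<open>0 < \<epsilon>\<close> by (simp add: e_def)
  qed
  then show "\<exists>n0. \<forall>n\<ge>n0. \<forall>m\<ge>n0. d_box_perm (\<sigma> n) (\<sigma> m) < \<epsilon>" by blast
qed

section \<open>Tuples and their order patterns\<close>

declare One_nat_def [simp del]

text \<open>The standardisation of a tuple, replacing entries by their ranks. Ties receive equal
  ranks, so the result is a permutation exactly for injective tuples; the identity outside
  \<open>{1..k}\<close> is what \<open>permutes\<close> demands.\<close>

definition std :: "nat \<Rightarrow> (nat \<Rightarrow> nat) \<Rightarrow> nat \<Rightarrow> nat" where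
  "std k x i = (if i \<in> {1..k} then card {j \<in> {1..k}. x j \<le> x i} else i)"

lemma finite_tuples: "finite {x \<in> {1..k::nat} \<rightarrow>\<^sub>E {1..n::nat}. P x}"
  by (rule finite_subset[of _ "{1..k} \<rightarrow>\<^sub>E {1..n}"]) (auto intro!: finite_PiE)

lemma std_less_iff:
  assumes "i \<in> {1..k}" "j \<in> {1..k}"
  shows "std k x i < std k x j \<longleftrightarrow> x i < x j"
proof -
  have less: "std k x i < std k x j" if "x i < x j" "i \<in> {1..k}" "j \<in> {1..k}" for i j
  proof -
    have "{l \<in> {1..k}. x l \<le> x i} \<subset> {l \<in> {1..k}. x l \<le> x j}"
      using that by (intro psubsetI) (auto, metis (mono_tags, lifting) atLeastAtMost_iff le_refl mem_Collect_eq not_le One_nat_def)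
    then have "card {l \<in> {1..k}. x l \<le> x i} < card {l \<in> {1..k}. x l \<le> x j}"
      by (intro psubset_card_mono) auto
    then show ?thesis using that by (simp add: std_def)
  qed
  have eq: "std k x i = std k x j" if "x i = x j" using that assms by (simp add: std_def)
  show ?thesis using less[of i j] less[of j i] eq assms by (metis less_asym less_irrefl linorder_neqE_nat)
qed

lemma std_permutes:
  assumes "inj_on x {1..k}"
  shows "std k x permutes {1..k}"
proof (rule bij_imp_permutes)
  have 1: "std k x ` {1..k} \<subseteq> {1..k}"
  proof
    fix y assume "y \<in> std k x ` {1..k}"
    then obtain i where i: "i \<in> {1..k}" "y = card {j \<in> {1..k}. x j \<le> x i}" by (auto simp: std_def)
    have "card {j \<in> {1..k}. x j \<le> x i} \<le> card {1..k}" by (rule card_mono) auto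
    moreover have "card {j \<in> {1..k}. x j \<le> x i} > 0" using i(1) by (subst card_gt_0_iff) auto
    ultimately show "y \<in> {1..k}" using i(2) by simp
  qed
  have 2: "inj_on (std k x) {1..k}"
  proof (rule inj_onI)
    fix i j assume ij: "i \<in> {1..k}" "j \<in> {1..k}" "std k x i = std k x j"
    then have "x i = x j" using std_less_iff[of i k j x] std_less_iff[of j k i x] by auto
    then show "i = j" using assms ij by (auto dest: inj_onD)
  qed
  show "bij_betw (std k x) {1..k} {1..k}"
    using 1 2 endo_inj_surj[of "{1..k}"] by (auto simp: bij_betw_def)
qed (simp only: std_def if_False)

lemma std_cong:
  assumes "\<And>i j. i \<in> {1..k} \<Longrightarrow> j \<in> {1..k} \<Longrightarrow> x i < x j \<longleftrightarrow> y i < y j"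
  shows "std k x = std k y"
proof
  fix i
  have "{j \<in> {1..k}. x j \<le> x i} = {j \<in> {1..k}. y j \<le> y i}" if "i \<in> {1..k}"
    using assms that by (auto simp: not_less[symmetric])
  then show "std k x i = std k y i" by (simp add: std_def)
qed

text \<open>The indices counted in the rank of \<open>\<rho> i\<close> are the preimage of
  \<open>{1..\<rho> i}\<close> under a bijection.\<close>

lemma std_permutation:
  assumes "\<rho> permutes {1..k}"
  shows "std k \<rho> = \<rho>"
proof
  fix i
  show "std k \<rho> i = \<rho> i"
  proof (cases "i \<in> {1..k}")
    case True
    have "\<rho> i \<in> {1..k}" using permutes_in_image[OF assms] True by blast
    then have "j \<in> {1..k} \<and> \<rho> j \<le> \<rho> i \<longleftrightarrow> \<rho> j \<in> {1..\<rho> i}" for j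
      using permutes_in_image[OF assms, of j] by auto
    then have "{j \<in> {1..k}. \<rho> j \<le> \<rho> i} = \<rho> -` {1..\<rho> i}" by blast
    moreover have "card (\<rho> -` {1..\<rho> i}) = \<rho> i"
      using card_vimage_inj[of \<rho> "{1..\<rho> i}"] permutes_inj[OF assms] permutes_surj[OF assms] by simp
    ultimately show ?thesis using True by (simp add: std_def)
  qed (use assms in \<open>auto simp: std_def permutes_not_in\<close>)
qed

lemma std_eq_iff:
  assumes "\<rho> permutes {1..k}"
  shows "std k x = \<rho> \<longleftrightarrow> (\<forall>i\<in>{1..k}. \<forall>j\<in>{1..k}. x i < x j \<longleftrightarrow> \<rho> i < \<rho> j)"
proof
  assume "std k x = \<rho>"
  then show "\<forall>i\<in>{1..k}. \<forall>j\<in>{1..k}. x i < x j \<longleftrightarrow> \<rho> i < \<rho> j" using std_less_iff by blast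
next
  assume "\<forall>i\<in>{1..k}. \<forall>j\<in>{1..k}. x i < x j \<longleftrightarrow> \<rho> i < \<rho> j"
  then have "std k x = std k \<rho>" by (intro std_cong) auto
  then show "std k x = \<rho>" using std_permutation[OF assms] by simp
qed

text \<open>Sorting the positions means composing with \<open>inv \<rho>\<close>. The sorted tuple
  is increasing and its values have pattern \<open>\<tau> \<circ> inv \<rho>\<close>; composing an
  occurrence with \<open>\<rho>\<close> undoes this.\<close>

lemma card_std_fibre:
  assumes \<rho>: "\<rho> permutes {1..k}" and \<tau>: "\<tau> permutes {1..k}"
  shows "card {x \<in> {1..k} \<rightarrow>\<^sub>E {1..len \<sigma>}. std k x = \<rho> \<and> std k (snd \<sigma> \<circ> x) = \<tau>}
    = occurrences (k, \<tau> \<circ> inv \<rho>) \<sigma>"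
proof -
  let ?I = "{1..k}"
  let ?A = "{x \<in> ?I \<rightarrow>\<^sub>E {1..len \<sigma>}. std k x = \<rho> \<and> std k (snd \<sigma> \<circ> x) = \<tau>}"
  let ?B = "{x \<in> ?I \<rightarrow>\<^sub>E {1..len \<sigma>}. strict_mono_on ?I x \<and>
     (\<forall>i\<in>?I. \<forall>j\<in>?I. snd \<sigma> (x i) < snd \<sigma> (x j) \<longleftrightarrow> \<tau> (inv \<rho> i) < \<tau> (inv \<rho> j))}"
  have in1: "\<rho> i \<in> ?I \<longleftrightarrow> i \<in> ?I" for i by (rule permutes_in_image[OF \<rho>])
  have in2: "inv \<rho> i \<in> ?I \<longleftrightarrow> i \<in> ?I" for i by (rule permutes_in_image[OF permutes_inv[OF \<rho>]])
  note inv = permutes_inverses[OF \<rho>]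
  have "bij_betw (\<lambda>x. restrict (x \<circ> inv \<rho>) ?I) ?A ?B"
  proof (rule bij_betw_byWitness[where f' = "\<lambda>z. restrict (z \<circ> \<rho>) ?I"])
    show "\<forall>x\<in>?A. restrict (restrict (x \<circ> inv \<rho>) ?I \<circ> \<rho>) ?I = x"
      using in1 by (auto simp: inv restrict_def PiE_def extensional_def fun_eq_iff)
    show "\<forall>z\<in>?B. restrict (restrict (z \<circ> \<rho>) ?I \<circ> inv \<rho>) ?I = z"
      using in2 by (auto simp: inv restrict_def PiE_def extensional_def fun_eq_iff)
    show "(\<lambda>x. restrict (x \<circ> inv \<rho>) ?I) ` ?A \<subseteq> ?B"
    proof (rule image_subsetI)
      fix x assume x: "x \<in> ?A"
      then have o: "\<And>i j. i \<in> ?I \<Longrightarrow> j \<in> ?I \<Longrightarrow> x i < x j \<longleftrightarrow> \<rho> i < \<rho> j"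
        "\<And>i j. i \<in> ?I \<Longrightarrow> j \<in> ?I \<Longrightarrow> snd \<sigma> (x i) < snd \<sigma> (x j) \<longleftrightarrow> \<tau> i < \<tau> j"
        by (auto simp: std_eq_iff[OF \<rho>] std_eq_iff[OF \<tau>])
      have "restrict (x \<circ> inv \<rho>) ?I \<in> ?I \<rightarrow>\<^sub>E {1..len \<sigma>}"
        using x in2 by (intro restrict_PiE_iff[THEN iffD2]) (auto simp: PiE_iff)
      moreover have "strict_mono_on ?I (restrict (x \<circ> inv \<rho>) ?I)"
        by (rule strict_mono_onI) (use o(1) in2 inv in auto)
      moreover have "\<forall>i\<in>?I. \<forall>j\<in>?I. snd \<sigma> (restrict (x \<circ> inv \<rho>) ?I i) < snd \<sigma> (restrict (x \<circ> inv \<rho>) ?I j)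
          \<longleftrightarrow> \<tau> (inv \<rho> i) < \<tau> (inv \<rho> j)"
        using o(2) in2 by simp
      ultimately show "restrict (x \<circ> inv \<rho>) ?I \<in> ?B" by blast
    qed
    show "(\<lambda>z. restrict (z \<circ> \<rho>) ?I) ` ?B \<subseteq> ?A"
    proof (rule image_subsetI)
      fix z assume z: "z \<in> ?B"
      have "restrict (z \<circ> \<rho>) ?I \<in> ?I \<rightarrow>\<^sub>E {1..len \<sigma>}"
        using z in1 by (intro restrict_PiE_iff[THEN iffD2]) (auto simp: PiE_iff)
      moreover have "std k (restrict (z \<circ> \<rho>) ?I) = \<rho>"
        unfolding std_eq_iff[OF \<rho>]
      proof (intro ballI)
        fix i j assume "i \<in> ?I" "j \<in> ?I"
        then show "restrict (z \<circ> \<rho>) ?I i < restrict (z \<circ> \<rho>) ?I j \<longleftrightarrow> \<rho> i < \<rho> j"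
          using z in1 strict_mono_on_less[of ?I z "\<rho> i" "\<rho> j"] by simp
      qed
      moreover have "std k (snd \<sigma> \<circ> restrict (z \<circ> \<rho>) ?I) = \<tau>"
        unfolding std_eq_iff[OF \<tau>] using z in1 by (simp add: inv)
      ultimately show "restrict (z \<circ> \<rho>) ?I \<in> ?A" by blast
    qed
  qed
  from bij_betw_same_card[OF this] show ?thesis by (simp add: occurrences_def)
qed

text \<open>Turns any event \<open>Q\<close> about the relative order of distinct points into a sum
  of pattern counts, by splitting tuples according to the patterns of their positions and of their
  values.\<close>

lemma card_injective_tuples:
  assumes "\<sigma> \<in> perms"
  shows "card {x \<in> {1..k} \<rightarrow>\<^sub>E {1..len \<sigma>}. inj_on x {1..k} \<and> Q (std k x) (std k (snd \<sigma> \<circ> x))}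
    = (\<Sum>(\<rho>, \<tau>) \<in> {(\<rho>, \<tau>). \<rho> permutes {1..k} \<and> \<tau> permutes {1..k} \<and> Q \<rho> \<tau>}.
        occurrences (k, \<tau> \<circ> inv \<rho>) \<sigma>)"
proof -
  let ?I = "{1..k}"
  let ?S = "{(\<rho>, \<tau>). \<rho> permutes ?I \<and> \<tau> permutes ?I \<and> Q \<rho> \<tau>}"
  define A where "A = (\<lambda>(\<rho>, \<tau>). {x \<in> ?I \<rightarrow>\<^sub>E {1..len \<sigma>}. std k x = \<rho> \<and> std k (snd \<sigma> \<circ> x) = \<tau>})"
  \<comment> \<open>Equal entries would have equal ranks, so tuples in the fibres over permutations
    are injective.\<close>
  have inj: "inj_on x ?I" if "std k x permutes ?I" for x
  proof (rule inj_onI)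
    fix i j assume "i \<in> ?I" "j \<in> ?I" "x i = x j"
    then have "std k x i = std k x j" by (simp add: std_def)
    then show "i = j" using permutes_inj[OF that] by (auto dest: injD)
  qed
  have inj': "inj_on (snd \<sigma> \<circ> x) ?I" if "inj_on x ?I" for x
    using that permutes_inj[OF permsD(2)[OF assms]] by (auto intro: comp_inj_on inj_on_subset)
  have "{x \<in> ?I \<rightarrow>\<^sub>E {1..len \<sigma>}. inj_on x ?I \<and> Q (std k x) (std k (snd \<sigma> \<circ> x))} = (\<Union>p\<in>?S. A p)"
    using inj inj' std_permutes[of _ k] by (fastforce simp: A_def)
  moreover have "card (\<Union>p\<in>?S. A p) = (\<Sum>p\<in>?S. card (A p))"
  proof (rule card_UN_disjoint)
    have "?S \<subseteq> {\<rho>. \<rho> permutes ?I} \<times> {\<rho>. \<rho> permutes ?I}" by auto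
    then show "finite ?S" by (rule finite_subset) (auto intro: finite_permutations)
    show "\<forall>p\<in>?S. finite (A p)" by (simp only: A_def case_prod_beta finite_tuples ball_simps) simp
    show "\<forall>p\<in>?S. \<forall>q\<in>?S. p \<noteq> q \<longrightarrow> A p \<inter> A q = {}" by (auto simp: A_def)
  qed
  moreover have "(\<Sum>p\<in>?S. card (A p)) = (\<Sum>(\<rho>, \<tau>)\<in>?S. occurrences (k, \<tau> \<circ> inv \<rho>) \<sigma>)"
    by (rule sum.cong) (auto simp: A_def card_std_fibre)
  ultimately show ?thesis by simp
qed

text \<open>All coordinates except \<open>j\<close> are chosen freely, and then at most
  \<open>B\<close> values remain for coordinate \<open>j\<close>.\<close>

lemma card_PiE_pair_le:
  assumes fin: "finite I" "finite A" and ij: "i \<in> I" "j \<in> I" "i \<noteq> j"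
    and R: "\<And>p. p \<in> A \<Longrightarrow> real (card {q \<in> A. R p q}) \<le> B"
  shows "real (card {x \<in> I \<rightarrow>\<^sub>E A. R (x i) (x j)}) \<le> real (card A) ^ (card I - 1) * B"
proof -
  let ?J = "I - {j}"
  let ?S = "Sigma (?J \<rightarrow>\<^sub>E A) (\<lambda>y. {q \<in> A. R (y i) q})"
  let ?f = "\<lambda>x. (restrict x ?J, x j)"
  have finS: "finite ?S" using fin by (intro finite_SigmaI finite_PiE) auto
  have "inj_on ?f {x \<in> I \<rightarrow>\<^sub>E A. R (x i) (x j)}"
  proof (rule inj_onI)
    fix x y assume x: "x \<in> {x \<in> I \<rightarrow>\<^sub>E A. R (x i) (x j)}" and y: "y \<in> {x \<in> I \<rightarrow>\<^sub>E A. R (x i) (x j)}"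
      and e: "?f x = ?f y"
    show "x = y"
    proof (rule PiE_ext[of x I "\<lambda>_. A"])
      fix l assume l: "l \<in> I"
      have "restrict x ?J l = restrict y ?J l" using e by (auto dest: fun_cong)
      then show "x l = y l" using e l by (cases "l = j") auto
    qed (use x y in auto)
  qed
  moreover have "?f ` {x \<in> I \<rightarrow>\<^sub>E A. R (x i) (x j)} \<subseteq> ?S"
    using ij by (auto simp: PiE_iff split: if_splits)
  ultimately have "card {x \<in> I \<rightarrow>\<^sub>E A. R (x i) (x j)} \<le> card ?S"
    using finS by (rule card_inj_on_le)
  then have "real (card {x \<in> I \<rightarrow>\<^sub>E A. R (x i) (x j)}) \<le> real (card ?S)" by simp
  also have "\<dots> = (\<Sum>y \<in> ?J \<rightarrow>\<^sub>E A. real (card {q \<in> A. R (y i) q}))"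
    using fin by (subst card_SigmaI) (auto intro: finite_PiE)
  also have "\<dots> \<le> (\<Sum>y \<in> ?J \<rightarrow>\<^sub>E A. B)" using ij by (intro sum_mono R) (auto simp: PiE_iff)
  also have "\<dots> = real (card A) ^ (card I - 1) * B"
    using fin ij by (simp add: card_PiE)
  finally show ?thesis .
qed

lemma card_UN_pairs_le:
  fixes B :: real
  assumes "finite I" "S \<subseteq> (\<Union>i\<in>I. \<Union>j\<in>I - {i}. A i j)"
    and "\<And>i j. i \<in> I \<Longrightarrow> j \<in> I - {i} \<Longrightarrow> finite (A i j) \<and> real (card (A i j)) \<le> B" "0 \<le> B"
  shows "real (card S) \<le> real (card I)^2 * B"
proof -
  have "card S \<le> card (\<Union>i\<in>I. \<Union>j\<in>I - {i}. A i j)"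
    using assms by (intro card_mono) auto
  also have "\<dots> \<le> (\<Sum>i\<in>I. card (\<Union>j\<in>I - {i}. A i j))" using assms(1) by (rule card_UN_le)
  also have "\<dots> \<le> (\<Sum>i\<in>I. \<Sum>j\<in>I - {i}. card (A i j))"
    using assms(1) by (intro sum_mono card_UN_le) auto
  finally have "real (card S) \<le> (\<Sum>i\<in>I. \<Sum>j\<in>I - {i}. real (card (A i j)))"
    by (simp flip: of_nat_sum)
  also have "\<dots> \<le> (\<Sum>i\<in>I. \<Sum>j\<in>I - {i}. B)" using assms(3) by (intro sum_mono) auto
  \<comment> \<open>Adding the diagonal terms only enlarges the sum and gives the square.\<close>
  also have "\<dots> \<le> (\<Sum>i\<in>I. \<Sum>j\<in>I. B)" using assms(1,4) by (intro sum_mono sum_mono2) auto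
  finally show ?thesis by (simp add: power2_eq_square mult.assoc)
qed

lemma card_non_injective_tuples_le:
  "real (card {x \<in> {1..k} \<rightarrow>\<^sub>E {1..n}. \<not> inj_on x {1..k}}) \<le> real k ^ 2 * real n ^ (k - 1)"
proof -
  let ?A = "\<lambda>i j. {x \<in> {1..k} \<rightarrow>\<^sub>E {1..n}. x i = x j}"
  have "real (card {x \<in> {1..k} \<rightarrow>\<^sub>E {1..n}. \<not> inj_on x {1..k}}) \<le> real (card {1..k}) ^ 2 * real n ^ (k - 1)"
  proof (rule card_UN_pairs_le[where A = ?A])
    fix i j assume ij: "i \<in> {1..k}" "j \<in> {1..k} - {i}"
    have "real (card {q \<in> {1..n}. p = q}) \<le> 1" for p
      using card_mono[of "{p}" "{q \<in> {1..n}. p = q}"] by (simp add: subset_iff One_nat_def)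
    then have "real (card (?A i j)) \<le> real (card {1..n}) ^ (card {1..k} - 1) * 1"
      using ij by (intro card_PiE_pair_le) auto
    then show "finite (?A i j) \<and> real (card (?A i j)) \<le> real n ^ (k - 1)"
      by (simp add: finite_tuples)
  qed (auto simp: inj_on_def)
  then show ?thesis by simp
qed

section \<open>From pattern densities to distribution functions\<close>

definition moment :: "perm \<Rightarrow> nat \<Rightarrow> nat \<Rightarrow> real" where
  "moment \<sigma> a b = (\<Sum>i=1..len \<sigma>. (real i / real (len \<sigma>)) ^ a * (real (snd \<sigma> i) / real (len \<sigma>)) ^ b)
     / real (len \<sigma>)"

text \<open>The last coordinate is a reference point \<open>p\<close>. Of \<open>n\<close> points,
  exactly \<open>p\<close> satisfy a condition of the first kind and exactly \<open>\<pi> p\<close>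
  one of the second kind, which is why the inequalities are weak.\<close>

definition moment_event :: "nat \<Rightarrow> nat \<Rightarrow> (nat \<Rightarrow> nat) \<Rightarrow> (nat \<Rightarrow> nat) \<Rightarrow> bool" where
  "moment_event a b x y \<longleftrightarrow>
     (\<forall>i\<in>{1..a}. x i \<le> x (a + b + 1)) \<and> (\<forall>i\<in>{a+1..a+b}. y i \<le> y (a + b + 1))"

text \<open>The left side is the rank of \<open>\<pi> p\<close>, and standardising a permutation
  does not change it.\<close>

lemma card_permutation_le:
  assumes "\<pi> permutes {1..n}" "p \<in> {1..n}"
  shows "card {q \<in> {1..n}. \<pi> q \<le> \<pi> p} = \<pi> p"
  using fun_cong[OF std_permutation[OF assms(1)], of p] assms(2) unfolding std_def by (simp only: if_True)

text \<open>Once the last coordinate is fixed to \<open>p\<close>, the event is a product set with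
  \<open>a\<close> factors of size \<open>p\<close>, \<open>b\<close> factors of size
  \<open>snd \<sigma> p\<close> and one singleton.\<close>

lemma power_sum_eq_card:
  assumes "\<sigma> \<in> perms"
  shows "(\<Sum>p=1..len \<sigma>. p ^ a * snd \<sigma> p ^ b)
    = card {x \<in> {1..a+b+1} \<rightarrow>\<^sub>E {1..len \<sigma>}. moment_event a b x (snd \<sigma> \<circ> x)}"
proof -
  let ?n = "len \<sigma>" and ?\<pi> = "snd \<sigma>" and ?I = "{1..a+b+1}"
  note p = permsD[OF assms]
  \<comment> \<open>\<open>T p i\<close> holds the admissible values of coordinate \<open>i\<close>
    when the reference point is \<open>p\<close>.\<close>
  define T where "T = (\<lambda>p i. if i \<le> a then {1..p} else if i \<le> a + b then {q \<in> {1..?n}. ?\<pi> q \<le> ?\<pi> p} else {p})"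
  have last: "x (a + b + 1) = p" if "x \<in> PiE ?I (T p)" for x p
    using PiE_mem[OF that, of "a + b + 1"] by (simp add: T_def)
  have "{x \<in> ?I \<rightarrow>\<^sub>E {1..?n}. moment_event a b x (?\<pi> \<circ> x)} = (\<Union>p\<in>{1..?n}. PiE ?I (T p))"
  proof (intro equalityI subsetI)
    fix x assume x: "x \<in> {x \<in> ?I \<rightarrow>\<^sub>E {1..?n}. moment_event a b x (?\<pi> \<circ> x)}"
    then have "x (a + b + 1) \<in> {1..?n}" by (auto simp: PiE_iff)
    moreover have "x \<in> PiE ?I (T (x (a + b + 1)))"
    proof (rule PiE_I)
      fix i assume i: "i \<in> ?I"
      then have "x i \<in> {1..?n}" using x by (auto simp: PiE_iff)
      then show "x i \<in> T (x (a + b + 1)) i"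
        using x i by (cases "i \<le> a"; cases "i = a + b + 1") (auto simp: T_def moment_event_def)
    qed (use x in \<open>auto simp: PiE_iff extensional_def\<close>)
    ultimately show "x \<in> (\<Union>p\<in>{1..?n}. PiE ?I (T p))" by blast
  next
    fix x assume "x \<in> (\<Union>p\<in>{1..?n}. PiE ?I (T p))"
    then obtain p where p: "p \<in> {1..?n}" "x \<in> PiE ?I (T p)" by blast
    have T: "T p i \<subseteq> {1..?n}" for i using p(1) by (auto simp: T_def)
    have "x \<in> ?I \<rightarrow>\<^sub>E {1..?n}" using PiE_mono[of ?I "T p" "\<lambda>_. {1..?n}"] p(2) T by blast
    moreover have "moment_event a b x (?\<pi> \<circ> x)"
      unfolding moment_event_def comp_def last[OF p(2)]
    proof (intro conjI ballI)
      fix i assume "i \<in> {1..a}"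
      then show "x i \<le> p" using PiE_mem[OF p(2), of i] by (simp add: T_def)
    next
      fix i assume "i \<in> {a+1..a+b}"
      then show "?\<pi> (x i) \<le> ?\<pi> p" using PiE_mem[OF p(2), of i] by (simp add: T_def)
    qed
    ultimately show "x \<in> {x \<in> ?I \<rightarrow>\<^sub>E {1..?n}. moment_event a b x (?\<pi> \<circ> x)}" by blast
  qed
  moreover have "card (\<Union>p\<in>{1..?n}. PiE ?I (T p)) = (\<Sum>p=1..?n. card (PiE ?I (T p)))"
  proof (rule card_UN_disjoint)
    show "\<forall>p\<in>{1..?n}. finite (PiE ?I (T p))" by (auto intro!: finite_PiE simp: T_def)
    show "\<forall>p\<in>{1..?n}. \<forall>q\<in>{1..?n}. p \<noteq> q \<longrightarrow> PiE ?I (T p) \<inter> PiE ?I (T q) = {}" using last by blast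
  qed simp
  moreover have "card (PiE ?I (T q)) = q ^ a * ?\<pi> q ^ b" if q: "q \<in> {1..?n}" for q
  proof -
    have "card (PiE ?I (T q)) = (\<Prod>i\<in>?I. card (T q i))" by (simp add: card_PiE)
    also have "\<dots> = (\<Prod>i\<in>{1..a} \<union> {a+1..a+b} \<union> {a+b+1}. card (T q i))"
      by (rule prod.cong) auto
    also have "\<dots> = (\<Prod>i\<in>{1..a}. card (T q i)) * (\<Prod>i\<in>{a+1..a+b}. card (T q i)) * card (T q (a+b+1))"
      by (subst prod.union_disjoint, auto)+
    also have "(\<Prod>i\<in>{1..a}. card (T q i)) = (\<Prod>i\<in>{1..a}. q)" by (rule prod.cong) (auto simp: T_def)
    also have "(\<Prod>i\<in>{a+1..a+b}. card (T q i)) = (\<Prod>i\<in>{a+1..a+b}. ?\<pi> q)"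
      using card_permutation_le[OF p(2) q] by (intro prod.cong) (auto simp: T_def)
    finally show ?thesis by (simp add: T_def)
  qed
  ultimately show ?thesis by simp
qed

lemma moment_eq_card:
  assumes "\<sigma> \<in> perms"
  shows "moment \<sigma> a b = real (card {x \<in> {1..a+b+1} \<rightarrow>\<^sub>E {1..len \<sigma>}. moment_event a b x (snd \<sigma> \<circ> x)})
    / real (len \<sigma>) ^ (a + b + 1)"
proof -
  have "moment \<sigma> a b = (\<Sum>i=1..len \<sigma>. real i ^ a * real (snd \<sigma> i) ^ b / real (len \<sigma>) ^ (a + b)) / real (len \<sigma>)"
    by (simp add: moment_def power_divide power_add)
  also have "\<dots> = real (\<Sum>i=1..len \<sigma>. i ^ a * snd \<sigma> i ^ b) / real (len \<sigma>) ^ (a + b + 1)"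
    by (simp add: sum_divide_distrib[symmetric] power_add)
  finally show ?thesis using power_sum_eq_card[OF assms] by simp
qed

text \<open>The event sees only relative order, so \<open>card_injective_tuples\<close> applies to
  it.\<close>

lemma moment_event_std:
  "moment_event a b (std (a + b + 1) x) (std (a + b + 1) y) \<longleftrightarrow> moment_event a b x y"
  unfolding moment_event_def not_less[symmetric] by (auto simp: std_less_iff)

text \<open>The pattern counts miss only tuples with a repeated entry, at most
  \<open>k^2 n^(k-1)\<close> of the \<open>n^k\<close>.\<close>

lemma moment_approx:
  assumes "\<sigma> \<in> perms" and k: "k = a + b + 1"
  shows "\<bar>moment \<sigma> a b - (\<Sum>(\<rho>, \<tau>) \<in> {(\<rho>, \<tau>). \<rho> permutes {1..k} \<and> \<tau> permutes {1..k} \<and> moment_event a b \<rho> \<tau>}.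
      real (occurrences (k, \<tau> \<circ> inv \<rho>) \<sigma>) / real (len \<sigma>) ^ k)\<bar> \<le> real k ^ 2 / real (len \<sigma>)"
proof -
  let ?T = "{1..k} \<rightarrow>\<^sub>E {1..len \<sigma>}"
  let ?S = "{(\<rho>, \<tau>). \<rho> permutes {1..k} \<and> \<tau> permutes {1..k} \<and> moment_event a b \<rho> \<tau>}"
  let ?n = "real (len \<sigma>)"
  let ?E = "{x \<in> ?T. moment_event a b x (snd \<sigma> \<circ> x)}"
  let ?J = "{x \<in> ?T. inj_on x {1..k} \<and> moment_event a b x (snd \<sigma> \<circ> x)}"
  let ?N = "{x \<in> ?T. \<not> inj_on x {1..k}}"
  have n: "0 < ?n" using permsD(1)[OF assms(1)] by simp
  have "card ?J = (\<Sum>(\<rho>, \<tau>)\<in>?S. occurrences (k, \<tau> \<circ> inv \<rho>) \<sigma>)"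
    using card_injective_tuples[OF assms(1), of k "moment_event a b"] unfolding k moment_event_std by simp
  then have sum: "(\<Sum>(\<rho>, \<tau>)\<in>?S. real (occurrences (k, \<tau> \<circ> inv \<rho>) \<sigma>) / ?n ^ k) = real (card ?J) / ?n ^ k"
    by (simp add: case_prod_beta sum_divide_distrib[symmetric])
  have "card ?J \<le> card ?E" by (rule card_mono) (auto simp: finite_tuples)
  have "card ?E \<le> card (?J \<union> ?N)" by (rule card_mono) (auto simp: finite_tuples)
  also have "\<dots> \<le> card ?J + card ?N" by (rule card_Un_le)
  finally have "\<bar>real (card ?E) - real (card ?J)\<bar> \<le> real k ^ 2 * ?n ^ (k - 1)"
    using \<open>card ?J \<le> card ?E\<close> card_non_injective_tuples_le[of k "len \<sigma>"] by linarith
  then have "\<bar>real (card ?E) - real (card ?J)\<bar> / ?n ^ k \<le> real k ^ 2 * ?n ^ (k - 1) / ?n ^ k"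
    by (rule divide_right_mono) simp
  also have "\<dots> = real k ^ 2 / ?n" using n by (simp add: k power_add)
  finally have "\<bar>real (card ?E) / ?n ^ k - real (card ?J) / ?n ^ k\<bar> \<le> real k ^ 2 / ?n"
    using n by (simp add: diff_divide_distrib[symmetric])
  then show ?thesis unfolding sum using moment_eq_card[OF assms(1), of a b] by (simp add: k)
qed

section \<open>Normalisation of pattern counts and convergence of moments\<close>

lemma binomial_ratio_tendsto: "(\<lambda>n. real (n choose k) / real n ^ k) \<longlonglongrightarrow> 1 / fact k"
proof -
  have "(\<lambda>n. \<Prod>i<k. (1 - real i / real n)) \<longlonglongrightarrow> (\<Prod>i<k. (1 - 0))"
    by (intro tendsto_prod tendsto_diff tendsto_const lim_const_over_n)
  then have "(\<lambda>n. (\<Prod>i<k. (1 - real i / real n)) / fact k) \<longlonglongrightarrow> 1 / fact k"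
    by (intro tendsto_divide) auto
  moreover have "eventually (\<lambda>n. (\<Prod>i<k. (1 - real i / real n)) / fact k = real (n choose k) / real n ^ k) sequentially"
  proof (rule eventually_sequentiallyI[of 1])
    fix n :: nat assume n: "1 \<le> n"
    have "real (n choose k) = (\<Prod>i<k. real n - real i) / fact k"
      by (simp add: binomial_gbinomial gbinomial_prod_rev atLeast0LessThan)
    moreover have "(\<Prod>i<k. real n - real i) / real n ^ k = (\<Prod>i<k. (1 - real i / real n))"
    proof -
      have "(\<Prod>i<k. (1 - real i / real n)) = (\<Prod>i<k. (real n - real i) / real n)"
        using n by (intro prod.cong) (auto simp: diff_divide_distrib)
      then show ?thesis by (simp add: prod_dividef)
    qed
    ultimately show "(\<Prod>i<k. (1 - real i / real n)) / fact k = real (n choose k) / real n ^ k"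
      by (metis divide_divide_eq_left mult.commute)
  qed
  ultimately show ?thesis by (rule Lim_transform_eventually)
qed

lemma convergent_eventually_cong:
  fixes f g :: "nat \<Rightarrow> real"
  assumes "eventually (\<lambda>n. f n = g n) sequentially"
  shows "convergent f \<longleftrightarrow> convergent g"
  using tendsto_cong[OF assms] unfolding convergent_def by simp

text \<open>The quotient of the two normalisations tends to \<open>1 / fact k\<close>, which is not
  0, so it may be multiplied or divided out. The default density 0 for short permutations concerns
  finitely many terms only.\<close>

lemma pattern_density_convergent_iff:
  assumes L: "filterlim (\<lambda>n. len (\<sigma> n)) at_top sequentially"
  shows "convergent (\<lambda>n. pattern_density \<tau> (\<sigma> n)) \<longleftrightarrow>
    convergent (\<lambda>n. real (occurrences \<tau> (\<sigma> n)) / real (len (\<sigma> n)) ^ len \<tau>)" (is "convergent ?d \<longleftrightarrow> convergent ?s")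
proof -
  let ?r = "\<lambda>n. real (len (\<sigma> n) choose len \<tau>) / real (len (\<sigma> n)) ^ len \<tau>"
  have r: "?r \<longlonglongrightarrow> 1 / fact (len \<tau>)" by (rule filterlim_compose[OF binomial_ratio_tendsto L])
  have ev: "eventually (\<lambda>n. 1 \<le> len (\<sigma> n) \<and> len \<tau> \<le> len (\<sigma> n)) sequentially"
    using eventually_conj[OF eventually_len_ge[OF L, of 1] eventually_len_ge[OF L, of "len \<tau>"]] .
  have 1: "eventually (\<lambda>n. ?s n = ?d n * ?r n) sequentially"
    using ev by eventually_elim (simp add: pattern_density_def)
  have 2: "eventually (\<lambda>n. ?d n = ?s n / ?r n) sequentially"
    using ev by eventually_elim (simp add: pattern_density_def)
  show ?thesis
  proof
    assume "convergent ?d"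
    then have "convergent (\<lambda>n. ?d n * ?r n)"
      by (rule convergent_mult[OF _ convergentI[OF r]])
    then show "convergent ?s" using convergent_eventually_cong[OF 1] by simp
  next
    assume "convergent ?s"
    then obtain l where "?s \<longlonglongrightarrow> l" by (auto simp: convergent_def)
    then have "convergent (\<lambda>n. ?s n / ?r n)" by (intro convergentI[OF tendsto_divide[OF _ r]]) simp_all
    then show "convergent ?d" using convergent_eventually_cong[OF 2] by simp
  qed
qed

text \<open>The approximating sequence may depend on \<open>e\<close>; this allows a polynomial
  degree or a grid to be fixed before the length grows.\<close>

lemma convergent_by_approximation:
  fixes f :: "nat \<Rightarrow> real"
  assumes "\<And>e. 0 < e \<Longrightarrow> \<exists>g. convergent g \<and> eventually (\<lambda>n. \<bar>f n - g n\<bar> \<le> e) sequentially"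
  shows "convergent f"
proof -
  have "Cauchy f"
    unfolding Cauchy_altdef2
  proof (intro allI impI)
    fix e :: real assume e: "0 < e"
    then obtain g where g: "convergent g" "eventually (\<lambda>n. \<bar>f n - g n\<bar> \<le> e / 4) sequentially"
      using assms[of "e / 4"] by auto
    have "Cauchy g" using g(1) by (rule convergent_Cauchy)
    then obtain N1 where N1: "\<And>m n. m \<ge> N1 \<Longrightarrow> n \<ge> N1 \<Longrightarrow> \<bar>g m - g n\<bar> < e / 4"
      using e unfolding Cauchy_def dist_real_def by (metis divide_pos_pos zero_less_numeral)
    obtain N2 where N2: "\<And>n. n \<ge> N2 \<Longrightarrow> \<bar>f n - g n\<bar> \<le> e / 4"
      using g(2) by (auto simp: eventually_sequentially)
    have "dist (f n) (f (max N1 N2)) < e" if "n \<ge> max N1 N2" for n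
    proof -
      have "N1 \<le> n" "N2 \<le> n" using that by auto
      then show ?thesis
        using N1[of n "max N1 N2"] N2[of n] N2[of "max N1 N2"] e unfolding dist_real_def by linarith
    qed
    then show "\<exists>N. \<forall>n\<ge>N. dist (f n) (f N) < e" by blast
  qed
  then show ?thesis by (rule Cauchy_convergent)
qed

lemma moment_convergent:
  assumes P: "\<And>n. \<sigma> n \<in> perms" and L: "filterlim (\<lambda>n. len (\<sigma> n)) at_top sequentially"
    and conv: "perm_convergent \<sigma>"
  shows "convergent (\<lambda>n. moment (\<sigma> n) a b)"
proof (rule convergent_by_approximation)
  fix e :: real assume e: "0 < e"
  define k where "k = a + b + 1"
  let ?S = "{(\<rho>, \<tau>). \<rho> permutes {1..k} \<and> \<tau> permutes {1..k} \<and> moment_event a b \<rho> \<tau>}"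
  let ?g = "\<lambda>n. \<Sum>(\<rho>, \<tau>)\<in>?S. real (occurrences (k, \<tau> \<circ> inv \<rho>) (\<sigma> n)) / real (len (\<sigma> n)) ^ k"
  have "convergent (\<lambda>n. real (occurrences (k, \<tau> \<circ> inv \<rho>) (\<sigma> n)) / real (len (\<sigma> n)) ^ k)"
    if "(\<rho>, \<tau>) \<in> ?S" for \<rho> \<tau>
  proof -
    have "(k, \<tau> \<circ> inv \<rho>) \<in> perms"
      using that by (auto simp: perms_def k_def intro: permutes_compose permutes_inv)
    then show ?thesis
      using conv pattern_density_convergent_iff[OF L, of "(k, \<tau> \<circ> inv \<rho>)"] by (simp add: perm_convergent_def)
  qed
  then have "convergent ?g"
    unfolding case_prod_beta by (intro convergent_sum) auto
  moreover have "eventually (\<lambda>n. real k ^ 2 / real (len (\<sigma> n)) < e) sequentially"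
    by (rule order_tendstoD(2)[OF inverse_len_tendsto_0[OF L] e])
  then have "eventually (\<lambda>n. \<bar>moment (\<sigma> n) a b - ?g n\<bar> \<le> e) sequentially"
  proof eventually_elim
    case (elim n)
    then show ?case using moment_approx[OF P k_def, of n] by linarith
  qed
  ultimately show "\<exists>g. convergent g \<and> eventually (\<lambda>n. \<bar>moment (\<sigma> n) a b - g n\<bar> \<le> e) sequentially"
    by blast
qed

text \<open>The indicator is first replaced by the continuous ramp falling from 1 to 0 between
  \<open>s\<close> and \<open>s + e\<close>, then by a Weierstrass polynomial. The ramp is wrong
  only on that strip. The bound 2 serves the estimate of a product of two such polynomials.\<close>

lemma ramp_approx:
  fixes s e :: real
  assumes "0 < e" "e \<le> 1"
  obtains a :: "nat \<Rightarrow> real" and d :: nat where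
    "\<And>x. 0 \<le> x \<Longrightarrow> x \<le> 1 \<Longrightarrow> \<bar>(\<Sum>i\<le>d. a i * x ^ i)\<bar> \<le> 2 \<and>
      \<bar>(if x \<le> s then 1 else 0) - (\<Sum>i\<le>d. a i * x ^ i)\<bar> \<le> e + (if s < x \<and> x \<le> s + e then 1 else 0)"
proof -
  define g where "g x = min 1 (max 0 ((s - x) / e + 1))" for x
  have "continuous_on {0..1} g" unfolding g_def using assms by (intro continuous_intros) auto
  then obtain p where p: "real_polynomial_function p" "\<And>x. x \<in> {0..1} \<Longrightarrow> \<bar>g x - p x\<bar> < e"
    using Stone_Weierstrass_real_polynomial_function[of "{0..1}" g e] assms by auto
  obtain a d where ad: "p = (\<lambda>x. \<Sum>i\<le>d. a i * x ^ i)"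
    using real_polynomial_function_imp_sum[OF p(1)] by blast
  have g01: "0 \<le> g x" "g x \<le> 1" for x by (auto simp: g_def)
  have g1: "g x = 1" if "x \<le> s" for x using that assms by (simp add: g_def)
  have g0: "g x = 0" if "s + e < x" for x
  proof -
    have "(s - x) / e \<le> - 1" using that assms by (simp add: pos_divide_le_eq)
    then show ?thesis by (simp add: g_def)
  qed
  show ?thesis
  proof (rule that[of a d])
    fix x :: real assume "0 \<le> x" "x \<le> 1"
    then have "\<bar>g x - p x\<bar> < e" using p(2) by simp
    then show "\<bar>(\<Sum>i\<le>d. a i * x ^ i)\<bar> \<le> 2 \<and>
      \<bar>(if x \<le> s then 1 else 0) - (\<Sum>i\<le>d. a i * x ^ i)\<bar> \<le> e + (if s < x \<and> x \<le> s + e then 1 else 0)"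
      using g01[of x] g1[of x] g0[of x] assms unfolding ad by (auto split: if_splits)
  qed
qed

lemma perm_cdf_eq_sum:
  "perm_cdf \<sigma> s t = (\<Sum>i=1..len \<sigma>. (if real i \<le> s * real (len \<sigma>) then 1 else 0) *
     (if real (snd \<sigma> i) \<le> t * real (len \<sigma>) then 1 else 0)) / real (len \<sigma>)"
proof -
  have "(\<Sum>i=1..len \<sigma>. (if real i \<le> s * real (len \<sigma>) then 1 else 0) *
     (if real (snd \<sigma> i) \<le> t * real (len \<sigma>) then 1 else 0 :: real)) =
     (\<Sum>i=1..len \<sigma>. if real i \<le> s * real (len \<sigma>) \<and> real (snd \<sigma> i) \<le> t * real (len \<sigma>) then 1 else 0)"
    by (rule sum.cong) auto
  then show ?thesis by (simp add: perm_cdf_def sum.If_cases Int_def)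
qed

lemma strip_sum_le:
  assumes "1 \<le> n" "0 \<le> e"
  shows "(\<Sum>i=1..n. if s < real i / real n \<and> real i / real n \<le> s + e then 1 else 0 :: real) \<le> e * real n + 1"
proof -
  have n: "0 < real n" using assms by simp
  have "(\<Sum>i=1..n. if s < real i / real n \<and> real i / real n \<le> s + e then 1 else 0 :: real)
    = real (card {i \<in> {1..n}. s < real i / real n \<and> real i / real n \<le> s + e})"
    by (simp add: sum.If_cases Int_def)
  also have "\<dots> \<le> real (card {i::nat. s * real n < real i \<and> real i \<le> (s + e) * real n})"
    using n by (intro of_nat_mono card_mono finite_nat_interval) (auto simp: pos_less_divide_eq pos_divide_le_eq)
  also have "\<dots> \<le> (s + e) * real n - s * real n + 1"
    using assms by (intro card_nat_interval_le mult_right_mono) auto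
  finally show ?thesis by (simp add: algebra_simps)
qed

text \<open>The average of \<open>p x * q y\<close> over the points of the permutation is a fixed
  linear combination of moments, and for polynomials close to the two indicators it is close to
  \<open>perm_cdf\<close>.\<close>

lemma perm_cdf_convergent_if_perm_convergent:
  assumes P: "\<And>n. \<sigma> n \<in> perms" and L: "filterlim (\<lambda>n. len (\<sigma> n)) at_top sequentially"
    and conv: "perm_convergent \<sigma>"
  shows "convergent (\<lambda>n. perm_cdf (\<sigma> n) s t)"
proof (rule convergent_by_approximation)
  fix e' :: real assume e': "0 < e'"
  \<comment> \<open>The total error below is \<open>6 e + 3/n\<close>, eventually less than
    \<open>7 e\<close>.\<close>
  define e where "e = min 1 (e' / 12)"
  have e: "0 < e" "e \<le> 1" "12 * e \<le> e'" using e' by (auto simp: e_def)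
  obtain a d where a: "\<And>x. 0 \<le> x \<Longrightarrow> x \<le> 1 \<Longrightarrow> \<bar>(\<Sum>i\<le>d. a i * x ^ i)\<bar> \<le> 2 \<and>
      \<bar>(if x \<le> s then 1 else 0) - (\<Sum>i\<le>d. a i * x ^ i)\<bar> \<le> e + (if s < x \<and> x \<le> s + e then 1 else 0)"
    by (rule ramp_approx[OF e(1,2), of s]) blast
  obtain b f where b: "\<And>x. 0 \<le> x \<Longrightarrow> x \<le> 1 \<Longrightarrow> \<bar>(\<Sum>i\<le>f. b i * x ^ i)\<bar> \<le> 2 \<and>
      \<bar>(if x \<le> t then 1 else 0) - (\<Sum>i\<le>f. b i * x ^ i)\<bar> \<le> e + (if t < x \<and> x \<le> t + e then 1 else 0)"
    by (rule ramp_approx[OF e(1,2), of t]) blast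
  define p where "p x = (\<Sum>i\<le>d. a i * x ^ i)" for x
  define q where "q x = (\<Sum>i\<le>f. b i * x ^ i)" for x
  define g where "g n = (\<Sum>i\<le>d. \<Sum>j\<le>f. a i * b j * moment (\<sigma> n) i j)" for n
  have "convergent g"
    unfolding g_def by (intro convergent_sum convergent_mult_const_iff[THEN iffD2] convergent_mult moment_convergent[OF P L conv] convergent_const)
  moreover have "eventually (\<lambda>n. 3 / real (len (\<sigma> n)) < e) sequentially"
    by (rule order_tendstoD(2)[OF inverse_len_tendsto_0[OF L] e(1)])
  then have "eventually (\<lambda>n. \<bar>perm_cdf (\<sigma> n) s t - g n\<bar> \<le> e') sequentially"
  proof eventually_elim
    case (elim k)
    define n \<pi> where "n = len (\<sigma> k)" and "\<pi> = snd (\<sigma> k)"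
    have n: "1 \<le> n" "0 < real n" and \<pi>: "\<pi> permutes {1..n}" using permsD[OF P[of k]] by (auto simp: n_def \<pi>_def)
    let ?x = "\<lambda>i. real i / real n" and ?y = "\<lambda>i. real (\<pi> i) / real n"
    let ?u = "\<lambda>x. if x \<le> s then 1 else 0 :: real" and ?v = "\<lambda>y. if y \<le> t then 1 else 0 :: real"
    let ?U = "\<lambda>x. if s < x \<and> x \<le> s + e then 1 else 0 :: real" and ?V = "\<lambda>y. if t < y \<and> y \<le> t + e then 1 else 0 :: real"
    have "g k = (\<Sum>i\<le>d. \<Sum>j\<le>f. \<Sum>l=1..n. a i * ?x l ^ i * (b j * ?y l ^ j)) / real n"
      by (simp add: g_def moment_def n_def \<pi>_def sum_divide_distrib sum_distrib_left mult_ac)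
    also have "(\<Sum>i\<le>d. \<Sum>j\<le>f. \<Sum>l=1..n. a i * ?x l ^ i * (b j * ?y l ^ j))
      = (\<Sum>l=1..n. \<Sum>i\<le>d. \<Sum>j\<le>f. a i * ?x l ^ i * (b j * ?y l ^ j))"
      by (subst sum.swap[of _ "{..d}" "{1..n}"]) (rule sum.cong[OF refl], rule sum.swap)
    also have "\<dots> = (\<Sum>l=1..n. p (?x l) * q (?y l))"
      by (simp add: p_def q_def sum_product)
    finally have g: "g k = (\<Sum>l=1..n. p (?x l) * q (?y l)) / real n" .
    have c: "perm_cdf (\<sigma> k) s t = (\<Sum>l=1..n. ?u (?x l) * ?v (?y l)) / real n"
      unfolding perm_cdf_eq_sum n_def[symmetric] \<pi>_def[symmetric] using n(2) by (simp add: pos_divide_le_eq)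
    have term_le: "\<bar>?u (?x l) * ?v (?y l) - p (?x l) * q (?y l)\<bar> \<le> 3 * e + ?U (?x l) + 2 * ?V (?y l)"
      if l: "l \<in> {1..n}" for l
    proof -
      have \<pi>l: "\<pi> l \<in> {1..n}" using permutes_in_image[OF \<pi>] l by blast
      have xy: "0 \<le> ?x l" "?x l \<le> 1" "0 \<le> ?y l" "?y l \<le> 1" using l \<pi>l n by auto
      have A: "\<bar>?u (?x l) - p (?x l)\<bar> \<le> e + ?U (?x l)" "\<bar>p (?x l)\<bar> \<le> 2"
        using a[OF xy(1,2)] by (auto simp: p_def)
      have B: "\<bar>?v (?y l) - q (?y l)\<bar> \<le> e + ?V (?y l)" using b[OF xy(3,4)] by (auto simp: q_def)
      \<comment> \<open>The factors are exchanged one at a time, with \<open>?v\<close> bounded by 1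
        and \<open>p\<close> by 2.\<close>
      have "?u (?x l) * ?v (?y l) - p (?x l) * q (?y l)
        = (?u (?x l) - p (?x l)) * ?v (?y l) + p (?x l) * (?v (?y l) - q (?y l))" by (simp add: algebra_simps)
      then have "\<bar>?u (?x l) * ?v (?y l) - p (?x l) * q (?y l)\<bar>
        \<le> \<bar>?u (?x l) - p (?x l)\<bar> * \<bar>?v (?y l)\<bar> + \<bar>p (?x l)\<bar> * \<bar>?v (?y l) - q (?y l)\<bar>"
        by (metis abs_mult abs_triangle_ineq)
      also have "\<dots> \<le> (e + ?U (?x l)) * 1 + 2 * (e + ?V (?y l))"
        by (intro add_mono mult_mono A B) (use e in auto)
      finally show ?thesis by (simp add: algebra_simps)
    qed
    \<comment> \<open>The heights are a rearrangement of the positions, so horizontal strips obey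
      the bound for vertical ones.\<close>
    have sumV: "(\<Sum>l=1..n. ?V (?y l)) = (\<Sum>l=1..n. ?V (?x l))"
      using sum.permute[OF \<pi>, of "\<lambda>l. ?V (?x l)"] by (simp add: comp_def)
    have "\<bar>(\<Sum>l=1..n. ?u (?x l) * ?v (?y l)) - (\<Sum>l=1..n. p (?x l) * q (?y l))\<bar>
      \<le> (\<Sum>l=1..n. 3 * e + ?U (?x l) + 2 * ?V (?y l))"
      unfolding sum_subtractf[symmetric] by (rule order_trans[OF sum_abs sum_mono]) (rule term_le)
    also have "\<dots> = 3 * e * real n + (\<Sum>l=1..n. ?U (?x l)) + 2 * (\<Sum>l=1..n. ?V (?x l))"
      unfolding sum.distrib sum_distrib_left[symmetric] sumV by simp
    also have "\<dots> \<le> 3 * e * real n + (e * real n + 1) + 2 * (e * real n + 1)"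
      by (intro add_mono mult_left_mono strip_sum_le n(1)) (use e in auto)
    also have "\<dots> = (6 * e + 3 / real n) * real n" using n(2) by (simp add: field_simps)
    finally have "\<bar>perm_cdf (\<sigma> k) s t - g k\<bar> \<le> 6 * e + 3 / real n"
      unfolding c g diff_divide_distrib[symmetric] using n(2) by (simp add: pos_divide_le_eq)
    then show ?case using elim e unfolding n_def by linarith
  qed
  ultimately show "\<exists>g. convergent g \<and> eventually (\<lambda>n. \<bar>perm_cdf (\<sigma> n) s t - g n\<bar> \<le> e') sequentially" by blast
qed

section \<open>From distribution functions to pattern densities\<close>

text \<open>Rounding up makes the cells half-open on the left, so that
  \<open>cell m n p \<le> u\<close> is precisely the threshold at \<open>u / m\<close> used in
  \<open>perm_cdf\<close>.\<close>

definition cell :: "nat \<Rightarrow> nat \<Rightarrow> nat \<Rightarrow> nat" where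
  "cell m n p = nat \<lceil>real p * real m / real n\<rceil>"

definition cell_count :: "nat \<Rightarrow> perm \<Rightarrow> nat \<Rightarrow> nat \<Rightarrow> nat" where
  "cell_count m \<sigma> u v = card {p \<in> {1..len \<sigma>}. cell m (len \<sigma>) p = u \<and> cell m (len \<sigma>) (snd \<sigma> p) = v}"

lemma cell_mono: "p \<le> q \<Longrightarrow> cell m n p \<le> cell m n q"
  unfolding cell_def by (intro nat_mono ceiling_mono divide_right_mono mult_right_mono) auto

lemma cell_less_imp: "cell m n p < cell m n q \<Longrightarrow> p < q"
  using cell_mono[of q p m n] by (meson not_less)

lemma cell_le_iff:
  assumes "1 \<le> n" "1 \<le> m"
  shows "cell m n p \<le> u \<longleftrightarrow> real p \<le> real u / real m * real n"
proof -
  have "cell m n p \<le> u \<longleftrightarrow> real p * real m / real n \<le> real u"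
    by (simp add: cell_def nat_le_iff ceiling_le_iff)
  also have "\<dots> \<longleftrightarrow> real p \<le> real u / real m * real n"
    using assms by (simp add: field_simps)
  finally show ?thesis .
qed

lemma cell_in:
  assumes "1 \<le> n" "1 \<le> m" "p \<in> {1..n}"
  shows "cell m n p \<in> {1..m}"
proof -
  have "cell m n p \<le> m" using cell_le_iff[OF assms(1,2), of p m] assms by simp
  moreover have "\<not> cell m n p \<le> 0" using cell_le_iff[OF assms(1,2), of p 0] assms by simp
  ultimately show ?thesis by simp
qed

lemma card_cell_le:
  assumes "1 \<le> n" "1 \<le> m"
  shows "real (card {q \<in> {1..n}. cell m n q = u}) \<le> real n / real m + 1"
proof -
  let ?a = "(real u - 1) / real m * real n" and ?b = "real u / real m * real n"
  have "{q \<in> {1..n}. cell m n q = u} \<subseteq> {q::nat. ?a < real q \<and> real q \<le> ?b}"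
  proof
    fix q assume q: "q \<in> {q \<in> {1..n}. cell m n q = u}"
    then have u: "1 \<le> u" using cell_in[OF assms, of q] by simp
    have "\<not> cell m n q \<le> u - 1" using q u by auto
    then have "?a < real q" using cell_le_iff[OF assms, of q "u - 1"] u by (simp add: of_nat_diff)
    moreover have "real q \<le> ?b" using cell_le_iff[OF assms, of q u] q by simp
    ultimately show "q \<in> {q::nat. ?a < real q \<and> real q \<le> ?b}" by blast
  qed
  from card_mono[OF finite_nat_interval this]
  have "real (card {q \<in> {1..n}. cell m n q = u}) \<le> real (card {q::nat. ?a < real q \<and> real q \<le> ?b})" by simp
  also have "\<dots> \<le> ?b - ?a + 1"
    by (intro card_nat_interval_le mult_right_mono divide_right_mono) auto
  also have "\<dots> = real n / real m + 1" by (simp add: diff_divide_distrib left_diff_distrib)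
  finally show ?thesis .
qed

lemma card_cell_permuted_le:
  assumes "\<sigma> \<in> perms" "1 \<le> m"
  shows "real (card {q \<in> {1..len \<sigma>}. cell m (len \<sigma>) (snd \<sigma> q) = u}) \<le> real (len \<sigma>) / real m + 1"
proof -
  note p = permsD[OF assms(1)]
  have "card {q \<in> {1..len \<sigma>}. cell m (len \<sigma>) (snd \<sigma> q) = u} \<le> card {q \<in> {1..len \<sigma>}. cell m (len \<sigma>) q = u}"
  proof (rule card_inj_on_le[of "snd \<sigma>"])
    show "inj_on (snd \<sigma>) {q \<in> {1..len \<sigma>}. cell m (len \<sigma>) (snd \<sigma> q) = u}"
      by (rule permutes_inj_on[OF p(2)])
    show "snd \<sigma> ` {q \<in> {1..len \<sigma>}. cell m (len \<sigma>) (snd \<sigma> q) = u} \<subseteq> {q \<in> {1..len \<sigma>}. cell m (len \<sigma>) q = u}"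
      using permutes_in_image[OF p(2)] by blast
  qed simp
  then show ?thesis using card_cell_le[OF p(1) assms(2), of u] by linarith
qed

text \<open>Inclusion-exclusion: the indicator of a cell is a product of two differences of
  threshold indicators. Positive \<open>u\<close> and \<open>v\<close> keep the subtraction on
  naturals from truncating.\<close>

lemma cell_count_eq_perm_cdf:
  assumes "\<sigma> \<in> perms" "1 \<le> m" "1 \<le> u" "1 \<le> v"
  shows "real (cell_count m \<sigma> u v) / real (len \<sigma>) =
    perm_cdf \<sigma> (real u / real m) (real v / real m) - perm_cdf \<sigma> (real (u - 1) / real m) (real v / real m)
    - perm_cdf \<sigma> (real u / real m) (real (v - 1) / real m)
    + perm_cdf \<sigma> (real (u - 1) / real m) (real (v - 1) / real m)"
proof -
  note p = permsD[OF assms(1)]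
  let ?n = "len \<sigma>" and ?\<pi> = "snd \<sigma>"
  define I where "I u p = (if cell m ?n p \<le> u then 1 else 0 :: real)" for u p
  have cdf: "perm_cdf \<sigma> (real u / real m) (real v / real m) = (\<Sum>p=1..?n. I u p * I v (?\<pi> p)) / real ?n" for u v
    unfolding perm_cdf_eq_sum cell_le_iff[OF p(1) assms(2), symmetric] I_def ..
  have "real (cell_count m \<sigma> u v) = (\<Sum>p=1..?n. if cell m ?n p = u \<and> cell m ?n (?\<pi> p) = v then 1 else 0)"
    by (simp add: cell_count_def sum.If_cases Int_def)
  also have "\<dots> = (\<Sum>p=1..?n. I u p * I v (?\<pi> p) - I (u - 1) p * I v (?\<pi> p) - I u p * I (v - 1) (?\<pi> p)
      + I (u - 1) p * I (v - 1) (?\<pi> p))"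
    using assms(3,4) by (intro sum.cong) (auto simp: I_def)
  finally show ?thesis
    by (simp add: cdf sum.distrib sum_subtractf diff_divide_distrib add_divide_distrib)
qed

text \<open>Assignments of columns \<open>u\<close> and rows \<open>v\<close> that force the
  pattern: any choice of points from these cells is an occurrence of \<open>\<tau>\<close>.\<close>

definition grid_patterns :: "nat \<Rightarrow> perm \<Rightarrow> ((nat \<Rightarrow> nat) \<times> (nat \<Rightarrow> nat)) set" where
  "grid_patterns m \<tau> = {(u, v). u \<in> {1..len \<tau>} \<rightarrow>\<^sub>E {1..m} \<and> v \<in> {1..len \<tau>} \<rightarrow>\<^sub>E {1..m} \<and>
     strict_mono_on {1..len \<tau>} u \<and>
     (\<forall>i\<in>{1..len \<tau>}. \<forall>j\<in>{1..len \<tau>}. v i < v j \<longleftrightarrow> snd \<tau> i < snd \<tau> j)}"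

text \<open>Let \<open>W\<close> be the tuples whose cells already display the pattern. They are
  occurrences, and any other occurrence has two points in a common column or row, which is rare.
  Grouping \<open>W\<close> by cells makes its size a sum of products of cell counts.\<close>

lemma occurrences_grid_approx:
  assumes \<tau>: "\<tau> \<in> perms" and \<sigma>: "\<sigma> \<in> perms" and m: "1 \<le> m"
  shows "\<bar>real (occurrences \<tau> \<sigma>) / real (len \<sigma>) ^ len \<tau>
      - (\<Sum>(u, v)\<in>grid_patterns m \<tau>. \<Prod>i=1..len \<tau>. real (cell_count m \<sigma> (u i) (v i)) / real (len \<sigma>))\<bar>
    \<le> 2 * real (len \<tau>) ^ 2 * (1 / real m + 1 / real (len \<sigma>))"
proof -
  note p = permsD[OF \<sigma>] permsD[OF \<tau>]
  let ?k = "len \<tau>" and ?n = "len \<sigma>" and ?\<pi> = "snd \<sigma>" and ?\<theta> = "snd \<tau>"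
  let ?I = "{1..?k}"
  let ?T = "?I \<rightarrow>\<^sub>E {1..?n}"
  let ?c = "cell m ?n"
  have n: "0 < real ?n" using p by simp
  have \<pi>in: "?\<pi> q \<in> {1..?n} \<longleftrightarrow> q \<in> {1..?n}" for q by (rule permutes_in_image[OF p(2)])
  have \<theta>: "?\<theta> i = ?\<theta> j \<longleftrightarrow> i = j" for i j using permutes_inj[OF p(4)] by (auto dest: injD)
  define O' where "O' = {x \<in> ?T. strict_mono_on ?I x \<and>
     (\<forall>i\<in>?I. \<forall>j\<in>?I. ?\<pi> (x i) < ?\<pi> (x j) \<longleftrightarrow> ?\<theta> i < ?\<theta> j)}"
  define W where "W = {x \<in> ?T. strict_mono_on ?I (\<lambda>i. ?c (x i)) \<and>
     (\<forall>i\<in>?I. \<forall>j\<in>?I. ?c (?\<pi> (x i)) < ?c (?\<pi> (x j)) \<longleftrightarrow> ?\<theta> i < ?\<theta> j)}"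
  define A where "A i j = {x \<in> ?T. ?c (x i) = ?c (x j)} \<union> {x \<in> ?T. ?c (?\<pi> (x i)) = ?c (?\<pi> (x j))}" for i j
  have fin: "finite O'" "finite W" unfolding O'_def W_def by (rule finite_tuples)+
  have WO: "W \<subseteq> O'"
  proof
    fix x assume x: "x \<in> W"
    have "strict_mono_on ?I x"
    proof (rule strict_mono_onI)
      fix i j assume "i \<in> ?I" "j \<in> ?I" "i < j"
      then have "?c (x i) < ?c (x j)"
        using x strict_mono_onD[of ?I "\<lambda>i. ?c (x i)" i j] by (simp add: W_def)
      then show "x i < x j" by (rule cell_less_imp)
    qed
    moreover have "?\<pi> (x i) < ?\<pi> (x j) \<longleftrightarrow> ?\<theta> i < ?\<theta> j" if ij: "i \<in> ?I" "j \<in> ?I" for i j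
    proof -
      \<comment> \<open>One direction for all index pairs suffices: \<open>?\<theta>\<close> is
        injective, so trichotomy yields the converse.\<close>
      have l: "?\<pi> (x i) < ?\<pi> (x j)" if "?\<theta> i < ?\<theta> j" "i \<in> ?I" "j \<in> ?I" for i j
        using x that cell_less_imp[of m ?n "?\<pi> (x i)" "?\<pi> (x j)"] unfolding W_def by blast
      show ?thesis using l[of i j] l[of j i] ij \<theta>[of i j] by (metis less_asym less_irrefl linorder_neqE_nat)
    qed
    ultimately show "x \<in> O'" using x by (simp add: O'_def W_def)
  qed
  have OW: "O' - W \<subseteq> (\<Union>i\<in>?I. \<Union>j\<in>?I - {i}. A i j)"
  proof (rule subsetI, rule ccontr)
    fix x assume x: "x \<in> O' - W" and nA: "x \<notin> (\<Union>i\<in>?I. \<Union>j\<in>?I - {i}. A i j)"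
    have T: "x \<in> ?T" using x by (simp add: O'_def)
    have sep: "?c (x i) \<noteq> ?c (x j)" "?c (?\<pi> (x i)) \<noteq> ?c (?\<pi> (x j))" if "i \<in> ?I" "j \<in> ?I" "i \<noteq> j" for i j
      using nA T that unfolding A_def by blast+
    have "strict_mono_on ?I (\<lambda>i. ?c (x i))"
    proof (rule strict_mono_onI)
      fix i j assume ij: "i \<in> ?I" "j \<in> ?I" "i < j"
      then have "x i < x j" using x strict_mono_onD[of ?I x i j] by (simp add: O'_def)
      then show "?c (x i) < ?c (x j)" using cell_mono[of "x i" "x j" m ?n] sep(1)[OF ij(1,2)] ij(3) by simp
    qed
    moreover have "?c (?\<pi> (x i)) < ?c (?\<pi> (x j)) \<longleftrightarrow> ?\<theta> i < ?\<theta> j" if ij: "i \<in> ?I" "j \<in> ?I" for i j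
    proof -
      have "?\<pi> (x i) < ?\<pi> (x j) \<longleftrightarrow> ?\<theta> i < ?\<theta> j" using x ij unfolding O'_def by blast
      moreover have "?c (?\<pi> (x i)) < ?c (?\<pi> (x j))" if "?\<pi> (x i) < ?\<pi> (x j)"
        using that cell_mono[of "?\<pi> (x i)" "?\<pi> (x j)" m ?n] sep(2)[OF ij] by (cases "i = j") auto
      ultimately show ?thesis using cell_less_imp[of m ?n "?\<pi> (x i)" "?\<pi> (x j)"] by blast
    qed
    ultimately have "x \<in> W" using T unfolding W_def by blast
    then show False using x by blast
  qed
  \<comment> \<open>The factor 2 covers sharing a column and sharing a row; a line of cells has at
    most \<open>n/m + 1\<close> points.\<close>
  let ?B = "2 * (real ?n ^ (?k - 1) * (real ?n / real m + 1))"
  have "real (card (O' - W)) \<le> real (card ?I) ^ 2 * ?B"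
  proof (rule card_UN_pairs_le[OF _ OW])
    fix i j assume ij: "i \<in> ?I" "j \<in> ?I - {i}"
    have 1: "real (card {x \<in> ?T. ?c (x i) = ?c (x j)}) \<le> real (card {1..?n}) ^ (card ?I - 1) * (real ?n / real m + 1)"
    proof (rule card_PiE_pair_le)
      have "{q \<in> {1..?n}. ?c r = ?c q} = {q \<in> {1..?n}. ?c q = ?c r}" for r by metis
      then show "real (card {q \<in> {1..?n}. ?c r = ?c q}) \<le> real ?n / real m + 1" for r
        using card_cell_le[OF p(1) m] by simp
    qed (use ij in auto)
    have 2: "real (card {x \<in> ?T. ?c (?\<pi> (x i)) = ?c (?\<pi> (x j))}) \<le> real (card {1..?n}) ^ (card ?I - 1) * (real ?n / real m + 1)"
    proof (rule card_PiE_pair_le)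
      have "{q \<in> {1..?n}. ?c (?\<pi> r) = ?c (?\<pi> q)} = {q \<in> {1..?n}. ?c (?\<pi> q) = ?c (?\<pi> r)}" for r by metis
      then show "real (card {q \<in> {1..?n}. ?c (?\<pi> r) = ?c (?\<pi> q)}) \<le> real ?n / real m + 1" for r
        using card_cell_permuted_le[OF \<sigma> m] by simp
    qed (use ij in auto)
    have "card (A i j) \<le> card {x \<in> ?T. ?c (x i) = ?c (x j)} + card {x \<in> ?T. ?c (?\<pi> (x i)) = ?c (?\<pi> (x j))}"
      unfolding A_def by (rule card_Un_le)
    then have "real (card (A i j)) \<le> ?B" using 1 2 by simp
    then show "finite (A i j) \<and> real (card (A i j)) \<le> ?B"
      unfolding A_def by (simp only: finite_tuples finite_Un simp_thms)
  qed auto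
  then have "\<bar>real (card O') - real (card W)\<bar> \<le> real ?k ^ 2 * ?B"
    using WO fin by (simp add: card_Diff_subset card_mono of_nat_diff)
  then have "\<bar>real (card O') - real (card W)\<bar> / real ?n ^ ?k \<le> real ?k ^ 2 * ?B / real ?n ^ ?k"
    by (rule divide_right_mono) simp
  also have "\<dots> = 2 * real ?k ^ 2 * (1 / real m + 1 / real ?n)"
  proof -
    have "real ?n ^ ?k = real ?n ^ (?k - 1) * real ?n"
      using p(3) by (metis Suc_diff_le diff_Suc_1 mult.commute power_Suc One_nat_def)
    then show ?thesis using n m by (simp add: field_simps)
  qed
  finally have main: "\<bar>real (card O') / real ?n ^ ?k - real (card W) / real ?n ^ ?k\<bar>
      \<le> 2 * real ?k ^ 2 * (1 / real m + 1 / real ?n)"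
    using n by (simp add: diff_divide_distrib[symmetric])
  let ?G = "grid_patterns m \<tau>"
  define F where "F = (\<lambda>(u, v). PiE ?I (\<lambda>i. {q \<in> {1..?n}. ?c q = u i \<and> ?c (?\<pi> q) = v i}))"
  have "W = (\<Union>g\<in>?G. F g)"
  proof (intro equalityI subsetI)
    fix x assume x: "x \<in> W"
    then have xi: "x i \<in> {1..?n}" if "i \<in> ?I" for i using that unfolding W_def by blast
    define u where "u = restrict (\<lambda>i. ?c (x i)) ?I"
    define v where "v = restrict (\<lambda>i. ?c (?\<pi> (x i))) ?I"
    have "(u, v) \<in> ?G"
      unfolding grid_patterns_def mem_Collect_eq prod.case
    proof (intro conjI)
      show "u \<in> ?I \<rightarrow>\<^sub>E {1..m}" "v \<in> ?I \<rightarrow>\<^sub>E {1..m}"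
        unfolding u_def v_def restrict_PiE_iff using cell_in[OF p(1) m] xi \<pi>in by blast+
      show "strict_mono_on ?I u"
        using x by (auto simp: W_def u_def strict_mono_on_def)
      show "\<forall>i\<in>?I. \<forall>j\<in>?I. (v i < v j) = (?\<theta> i < ?\<theta> j)" using x by (simp add: W_def v_def)
    qed
    moreover have "x \<in> F (u, v)"
      using x xi unfolding F_def W_def prod.case by (intro PiE_I) (auto simp: u_def v_def PiE_iff extensional_def)
    ultimately show "x \<in> (\<Union>g\<in>?G. F g)" by blast
  next
    fix x assume "x \<in> (\<Union>g\<in>?G. F g)"
    then obtain u v where uv: "(u, v) \<in> ?G" "x \<in> F (u, v)" by auto
    then have xi: "x i \<in> {1..?n} \<and> ?c (x i) = u i \<and> ?c (?\<pi> (x i)) = v i" if "i \<in> ?I" for i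
      using that unfolding F_def by (auto dest!: PiE_mem)
    have "x \<in> ?T" using uv(2) unfolding F_def by (auto simp: PiE_iff)
    moreover have "strict_mono_on ?I (\<lambda>i. ?c (x i))"
      using uv(1) xi by (auto simp: grid_patterns_def strict_mono_on_def)
    moreover have "\<forall>i\<in>?I. \<forall>j\<in>?I. ?c (?\<pi> (x i)) < ?c (?\<pi> (x j)) \<longleftrightarrow> ?\<theta> i < ?\<theta> j"
      using uv(1) xi by (simp add: grid_patterns_def)
    ultimately show "x \<in> W" unfolding W_def by blast
  qed
  moreover have "card (\<Union>g\<in>?G. F g) = (\<Sum>g\<in>?G. card (F g))"
  proof (rule card_UN_disjoint)
    have "?G \<subseteq> (?I \<rightarrow>\<^sub>E {1..m}) \<times> (?I \<rightarrow>\<^sub>E {1..m})" by (auto simp: grid_patterns_def)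
    then show "finite ?G" by (rule finite_subset) (auto intro!: finite_PiE)
    show "\<forall>g\<in>?G. finite (F g)" by (auto simp: F_def intro!: finite_PiE)
    \<comment> \<open>The fibres are disjoint because a tuple determines the cells of its
      points.\<close>
    have "g = h" if gh: "g \<in> ?G" "h \<in> ?G" "x \<in> F g" "x \<in> F h" for g h x
    proof -
      have F: "fst f i = ?c (x i) \<and> snd f i = ?c (?\<pi> (x i))" if "x \<in> F f" "i \<in> ?I" for f i
        using PiE_mem[OF that(1)[unfolded F_def case_prod_beta] that(2)] by simp
      have G: "fst f \<in> ?I \<rightarrow>\<^sub>E {1..m}" "snd f \<in> ?I \<rightarrow>\<^sub>E {1..m}" if "f \<in> ?G" for f
        using that by (simp_all add: grid_patterns_def case_prod_beta)
      have "fst g = fst h" by (rule PiE_ext[OF G(1) G(1)]) (use gh F in simp_all)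
      moreover have "snd g = snd h" by (rule PiE_ext[OF G(2) G(2)]) (use gh F in simp_all)
      ultimately show ?thesis by (rule prod_eqI)
    qed
    then show "\<forall>g\<in>?G. \<forall>h\<in>?G. g \<noteq> h \<longrightarrow> F g \<inter> F h = {}" by blast
  qed
  moreover have "real (card (F g)) / real ?n ^ ?k
      = (\<Prod>i=1..?k. real (cell_count m \<sigma> (fst g i) (snd g i)) / real ?n)" for g
    by (simp add: F_def card_PiE cell_count_def prod_dividef case_prod_beta)
  ultimately have "real (card W) / real ?n ^ ?k
      = (\<Sum>(u, v)\<in>?G. \<Prod>i=1..?k. real (cell_count m \<sigma> (u i) (v i)) / real ?n)"
    by (simp add: sum_divide_distrib case_prod_beta)
  then show ?thesis using main unfolding O'_def occurrences_def by simp
qed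

lemma convergent_finite_prod:
  fixes f :: "'a \<Rightarrow> nat \<Rightarrow> real"
  assumes "\<And>i. i \<in> I \<Longrightarrow> convergent (f i)"
  shows "convergent (\<lambda>n. \<Prod>i\<in>I. f i n)"
  using assms by (induction I rule: infinite_finite_induct) (auto intro: convergent_const convergent_mult)

text \<open>For a fixed grid the approximating polynomial in the cell masses converges, since these
  are combinations of values of \<open>perm_cdf\<close>. The grid contributes the error
  \<open>C/m\<close>, chosen below \<open>e/2\<close> in advance, and the length contributes
  \<open>C/n\<close>.\<close>

lemma perm_convergent_if_perm_cdf_convergent:
  assumes P: "\<And>n. \<sigma> n \<in> perms" and L: "filterlim (\<lambda>n. len (\<sigma> n)) at_top sequentially"
    and conv: "\<And>s t. 0 \<le> s \<Longrightarrow> s \<le> 1 \<Longrightarrow> 0 \<le> t \<Longrightarrow> t \<le> 1 \<Longrightarrow> convergent (\<lambda>n. perm_cdf (\<sigma> n) s t)"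
  shows "perm_convergent \<sigma>"
  unfolding perm_convergent_def
proof
  fix \<tau> assume \<tau>: "\<tau> \<in> perms"
  let ?k = "len \<tau>"
  have "convergent (\<lambda>n. real (occurrences \<tau> (\<sigma> n)) / real (len (\<sigma> n)) ^ ?k)"
  proof (rule convergent_by_approximation)
    fix e :: real assume e: "0 < e"
    define C where "C = 2 * real ?k ^ 2"
    have C: "0 < C" using permsD(1)[OF \<tau>] by (simp add: C_def)
    obtain M where M: "1 / real (Suc M) < e / (2 * C)"
      using nat_approx_posE[of "e / (2 * C)"] e C by (metis divide_pos_pos mult_pos_pos zero_less_numeral)
    define m where "m = Suc M"
    have m: "1 \<le> m" "C * (1 / real m) < e / 2"
      using M C by (auto simp: m_def field_simps)
    let ?g = "\<lambda>n. \<Sum>(u, v)\<in>grid_patterns m \<tau>. \<Prod>i=1..?k. real (cell_count m (\<sigma> n) (u i) (v i)) / real (len (\<sigma> n))"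
    have cc: "convergent (\<lambda>n. real (cell_count m (\<sigma> n) u v) / real (len (\<sigma> n)))"
      if "u \<in> {1..m}" "v \<in> {1..m}" for u v
      using that m
      by (subst cell_count_eq_perm_cdf[OF P m(1)]) (auto intro!: convergent_add convergent_diff conv)
    have "convergent ?g"
      unfolding case_prod_beta
    proof (intro convergent_sum convergent_finite_prod cc)
      fix g i assume "g \<in> grid_patterns m \<tau>" "i \<in> {1..?k}"
      then show "fst g i \<in> {1..m}" "snd g i \<in> {1..m}" unfolding grid_patterns_def by auto
    qed
    moreover have "eventually (\<lambda>n. C / real (len (\<sigma> n)) < e / 2) sequentially"
      by (rule order_tendstoD(2)[OF inverse_len_tendsto_0[OF L]]) (use e in simp)
    then have "eventually (\<lambda>n. \<bar>real (occurrences \<tau> (\<sigma> n)) / real (len (\<sigma> n)) ^ ?k - ?g n\<bar> \<le> e) sequentially"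
    proof eventually_elim
      case (elim n)
      have "C * (1 / real m + 1 / real (len (\<sigma> n))) = C * (1 / real m) + C / real (len (\<sigma> n))"
        by (simp add: distrib_left)
      then show ?case using occurrences_grid_approx[OF \<tau> P[of n] m(1)] elim m(2) unfolding C_def by linarith
    qed
    ultimately show "\<exists>g. convergent g \<and>
      eventually (\<lambda>n. \<bar>real (occurrences \<tau> (\<sigma> n)) / real (len (\<sigma> n)) ^ ?k - g n\<bar> \<le> e) sequentially" by blast
  qed
  then show "convergent (\<lambda>n. pattern_density \<tau> (\<sigma> n))" using pattern_density_convergent_iff[OF L] by simp
qed

section \<open>Bounded lengths\<close>

text \<open>Every \<open>k\<close>-subset is the image of its increasing enumeration.\<close>

lemma card_strict_mono_tuples_ge:
  "n choose k \<le> card {x \<in> {1..k} \<rightarrow>\<^sub>E {1..n::nat}. strict_mono_on {1..k::nat} x}"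
proof -
  let ?X = "{x \<in> {1..k} \<rightarrow>\<^sub>E {1..n}. strict_mono_on {1..k} x}"
  have "{S. S \<subseteq> {1..n} \<and> card S = k} \<subseteq> (\<lambda>x. x ` {1..k}) ` ?X"
  proof
    fix S assume "S \<in> {S. S \<subseteq> {1..n} \<and> card S = k}"
    then have S: "S \<subseteq> {1..n}" "card S = k" by auto
    then have "finite S" using finite_subset by blast
    then obtain h where h: "bij_betw h {..<card S} S" "strict_mono_on {..<card S} h"
      using ex_bij_betw_strict_mono_card by metis
    \<comment> \<open>The enumeration \<open>h\<close> starts at index 0 and the tuple at index
      1.\<close>
    define x where "x = restrict (\<lambda>i. h (i - 1)) {1..k}"
    have "(\<lambda>i. i - 1) ` {1..k} = {..<k}"
    proof (intro equalityI subsetI)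
      fix i assume "i \<in> {..<k}"
      then show "i \<in> (\<lambda>i. i - 1) ` {1..k}" by (intro image_eqI[of _ _ "Suc i"]) auto
    qed auto
    then have "x ` {1..k} = h ` {..<k}" unfolding x_def by (metis image_image image_restrict_eq)
    then have img: "x ` {1..k} = S" using h(1) S(2) by (simp add: bij_betw_def)
    have "x \<in> {1..k} \<rightarrow>\<^sub>E {1..n}"
      using img S(1) by (intro PiE_I) (blast, simp only: x_def restrict_apply if_False)
    moreover have "strict_mono_on {1..k} x"
    proof (rule strict_mono_onI)
      fix i j assume "i \<in> {1..k}" "j \<in> {1..k}" "i < j"
      then show "x i < x j" using strict_mono_onD[OF h(2), of "i - 1" "j - 1"] S(2) by (auto simp: x_def)
    qed
    ultimately show "S \<in> (\<lambda>x. x ` {1..k}) ` ?X" using img by blast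
  qed
  then have "card {S. S \<subseteq> {1..n} \<and> card S = k} \<le> card ((\<lambda>x. x ` {1..k}) ` ?X)"
    by (intro card_mono finite_imageI finite_tuples)
  also have "\<dots> \<le> card ?X" by (intro card_image_le finite_tuples)
  finally show ?thesis by (simp add: n_subsets)
qed

text \<open>Every increasing tuple of positions is an occurrence of the standardisation of its
  values.\<close>

lemma sum_pattern_density_ge_1:
  assumes "\<sigma> \<in> perms" "k \<le> len \<sigma>"
  shows "1 \<le> (\<Sum>\<tau> | \<tau> permutes {1..k}. pattern_density (k, \<tau>) \<sigma>)"
proof -
  let ?X = "{x \<in> {1..k} \<rightarrow>\<^sub>E {1..len \<sigma>}. strict_mono_on {1..k} x}"
  define O' where "O' \<tau> = {x \<in> {1..k} \<rightarrow>\<^sub>E {1..len \<sigma>}. strict_mono_on {1..k} x \<and>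
     (\<forall>i\<in>{1..k}. \<forall>j\<in>{1..k}. snd \<sigma> (x i) < snd \<sigma> (x j) \<longleftrightarrow> \<tau> i < \<tau> j)}" for \<tau> :: "nat \<Rightarrow> nat"
  have occ: "occurrences (k, \<tau>) \<sigma> = card (O' \<tau>)" for \<tau> by (simp add: occurrences_def O'_def)
  have "?X \<subseteq> (\<Union>\<tau>\<in>{\<tau>. \<tau> permutes {1..k}}. O' \<tau>)"
  proof
    fix x assume x: "x \<in> ?X"
    then have "inj_on x {1..k}" by (auto dest: strict_mono_on_imp_inj_on)
    then have "inj_on (snd \<sigma> \<circ> x) {1..k}"
      using permutes_inj[OF permsD(2)[OF assms(1)]] by (auto intro: comp_inj_on inj_on_subset)
    then have "std k (snd \<sigma> \<circ> x) permutes {1..k}" by (rule std_permutes)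
    moreover have "x \<in> O' (std k (snd \<sigma> \<circ> x))" using x by (simp add: O'_def std_less_iff del: atLeastAtMost_iff)
    ultimately show "x \<in> (\<Union>\<tau>\<in>{\<tau>. \<tau> permutes {1..k}}. O' \<tau>)" by blast
  qed
  then have "card ?X \<le> card (\<Union>\<tau>\<in>{\<tau>. \<tau> permutes {1..k}}. O' \<tau>)"
    by (rule card_mono[rotated]) (auto simp: O'_def finite_tuples finite_permutations)
  also have "\<dots> \<le> (\<Sum>\<tau> | \<tau> permutes {1..k}. card (O' \<tau>))" by (intro card_UN_le finite_permutations) simp
  finally have "len \<sigma> choose k \<le> (\<Sum>\<tau> | \<tau> permutes {1..k}. occurrences (k, \<tau>) \<sigma>)"
    unfolding occ using card_strict_mono_tuples_ge order_trans by blast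
  then have "real (len \<sigma> choose k) \<le> (\<Sum>\<tau> | \<tau> permutes {1..k}. real (occurrences (k, \<tau>) \<sigma>))"
    by (simp flip: of_nat_sum)
  moreover have "0 < real (len \<sigma> choose k)" using assms(2) by simp
  ultimately show ?thesis
    using assms(2) by (simp add: pattern_density_def sum_divide_distrib[symmetric] pos_le_divide_eq)
qed

lemma bdd_above_if_eventually_le:
  fixes f :: "nat \<Rightarrow> nat"
  assumes "eventually (\<lambda>n. f n \<le> K) sequentially"
  shows "bdd_above (range f)"
proof -
  obtain N where N: "\<And>n. n \<ge> N \<Longrightarrow> f n \<le> K" using assms by (auto simp: eventually_sequentially)
  have "f n \<in> f ` {..<N} \<union> {..K}" for n using N[of n] by (cases "n < N") auto
  then have "range f \<subseteq> f ` {..<N} \<union> {..K}" by blast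
  then have "finite (range f)" by (rule finite_subset) simp
  then show ?thesis by (rule bdd_above_finite)
qed

text \<open>If lengths fall below \<open>K\<close> infinitely often, the sum of all densities of
  length \<open>K\<close> vanishes infinitely often, so its limit is 0. It is then eventually below
  1, which excludes lengths of \<open>K\<close> or more and makes the lengths bounded.\<close>

lemma lengths_bounded_or_to_infinity_if_perm_convergent:
  assumes P: "\<And>n. \<sigma> n \<in> perms" and conv: "perm_convergent \<sigma>"
  shows "lengths_bounded_or_to_infinity \<sigma>"
proof (rule ccontr)
  assume "\<not> lengths_bounded_or_to_infinity \<sigma>"
  then have nb: "\<not> bdd_above (range (\<lambda>n. len (\<sigma> n)))"
    and nl: "\<not> filterlim (\<lambda>n. len (\<sigma> n)) at_top sequentially"
    by (auto simp: lengths_bounded_or_to_infinity_def)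
  \<comment> \<open>A positive \<open>K\<close> is chosen so that the patterns of length
    \<open>K\<close> belong to \<open>perms\<close>.\<close>
  obtain K where K: "1 \<le> K" "\<not> eventually (\<lambda>n. K \<le> len (\<sigma> n)) sequentially"
    using nl unfolding filterlim_at_top_ge[where c = 1] by blast
  define F where "F n = (\<Sum>\<tau> | \<tau> permutes {1..K}. pattern_density (K, \<tau>) (\<sigma> n))" for n
  have "convergent F"
    unfolding F_def using conv K(1) by (intro convergent_sum) (auto simp: perm_convergent_def perms_def)
  then obtain l where l: "F \<longlonglongrightarrow> l" by (auto simp: convergent_def)
  have F0: "F n = 0" if "\<not> K \<le> len (\<sigma> n)" for n
    using that by (simp add: F_def pattern_density_def)
  have "l = 0"
  proof (rule ccontr)
    assume "l \<noteq> 0"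
    then have "eventually (\<lambda>n. F n \<noteq> 0) sequentially" by (rule tendsto_imp_eventually_ne[OF l])
    then have "eventually (\<lambda>n. K \<le> len (\<sigma> n)) sequentially" by eventually_elim (use F0 in blast)
    then show False using K(2) by blast
  qed
  then have "eventually (\<lambda>n. F n < 1) sequentially" using order_tendstoD(2)[OF l, of 1] by simp
  then have "eventually (\<lambda>n. len (\<sigma> n) \<le> K) sequentially"
    by eventually_elim (use sum_pattern_density_ge_1[OF P, of K] F_def in \<open>force simp: not_le[symmetric]\<close>)
  then have "bdd_above (range (\<lambda>n. len (\<sigma> n)))" by (rule bdd_above_if_eventually_le)
  then show False using nb by simp
qed

section \<open>Sequences with finitely many values are eventually constant under either
  notion\<close>

lemma pattern_density_self:
  assumes "\<sigma> \<in> perms"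
  shows "0 < pattern_density \<sigma> \<sigma>"
proof -
  let ?O = "{x \<in> {1..len \<sigma>} \<rightarrow>\<^sub>E {1..len \<sigma>}. strict_mono_on {1..len \<sigma>} x \<and>
     (\<forall>i\<in>{1..len \<sigma>}. \<forall>j\<in>{1..len \<sigma>}. snd \<sigma> (x i) < snd \<sigma> (x j) \<longleftrightarrow> snd \<sigma> i < snd \<sigma> j)}"
  have "restrict id {1..len \<sigma>} \<in> ?O" by (auto simp: strict_mono_on_def)
  moreover have "finite ?O" by (rule finite_tuples)
  ultimately have "0 < card ?O" unfolding card_gt_0_iff by blast
  then show ?thesis by (simp add: pattern_density_def occurrences_def)
qed

text \<open>An occurrence at full length is a strictly increasing self-map of \<open>{1..n}\<close>,
  which can only be the identity.\<close>

lemma perm_eq_if_pattern_density_pos: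
  assumes "\<tau> \<in> perms" "\<sigma> \<in> perms" "len \<tau> = len \<sigma>" "0 < pattern_density \<tau> \<sigma>"
  shows "\<tau> = \<sigma>"
proof -
  let ?k = "len \<sigma>" and ?I = "{1..len \<sigma>}"
  note p = permsD(2)[OF assms(1)] permsD(2)[OF assms(2)]
  have "occurrences \<tau> \<sigma> \<noteq> 0" using assms(3,4) by (auto simp: pattern_density_def)
  then have "{x \<in> ?I \<rightarrow>\<^sub>E ?I. strict_mono_on ?I x \<and>
     (\<forall>i\<in>?I. \<forall>j\<in>?I. snd \<sigma> (x i) < snd \<sigma> (x j) \<longleftrightarrow> snd \<tau> i < snd \<tau> j)} \<noteq> {}"
    unfolding occurrences_def assms(3) by (metis card.empty)
  then obtain x where x: "x \<in> ?I \<rightarrow>\<^sub>E ?I" "strict_mono_on ?I x"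
    "\<And>i j. i \<in> ?I \<Longrightarrow> j \<in> ?I \<Longrightarrow> snd \<sigma> (x i) < snd \<sigma> (x j) \<longleftrightarrow> snd \<tau> i < snd \<tau> j" by blast
  define x' where "x' i = (if i \<in> ?I then x i else i)" for i
  have "x' permutes ?I"
  proof (rule bij_imp_permutes)
    have "inj_on x' ?I"
      using strict_mono_on_imp_inj_on[OF x(2)] inj_on_cong[of ?I x' x] by (simp add: x'_def)
    moreover have "x' ` ?I \<subseteq> ?I" using PiE_mem[OF x(1)] by (intro image_subsetI) (simp add: x'_def)
    ultimately show "bij_betw x' ?I ?I" using endo_inj_surj[of ?I x'] by (simp add: bij_betw_def)
  qed (simp only: x'_def if_False)
  \<comment> \<open>Both \<open>x'\<close> and the identity are permutations with the same relative
    order, so they share their standardisation and coincide.\<close>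
  then have "x' = std ?k x'" by (simp add: std_permutation)
  also have "\<dots> = std ?k id"
    by (rule std_cong) (use strict_mono_on_less[OF x(2)] in \<open>simp add: x'_def del: atLeastAtMost_iff\<close>)
  also have "\<dots> = id" by (rule std_permutation) (rule permutes_id)
  finally have id: "x' = id" .
  have xi: "x i = i" if "i \<in> ?I" for i using that fun_cong[OF id, of i] unfolding x'_def by (simp only: if_True id_apply)
  have "std ?k (snd \<sigma>) = std ?k (snd \<tau>)" by (rule std_cong) (use x(3) xi in simp)
  then have "std ?k (snd \<sigma>) = snd \<tau>" using std_permutation[OF p(1)] assms(3) by simp
  then have "snd \<sigma> = snd \<tau>" using std_permutation[OF p(2)] by simp
  then show ?thesis using assms(3) by (simp add: prod_eq_iff)
qed

lemma convergent_frequent_values_eq: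
  fixes f :: "nat \<Rightarrow> real"
  assumes "convergent f" "infinite {n. f n = a}" "infinite {n. f n = b}"
  shows "a = b"
proof -
  obtain l where l: "f \<longlonglongrightarrow> l" using assms(1) by (auto simp: convergent_def)
  have "l = c" if "infinite {n. f n = c}" for c
  proof (rule ccontr)
    assume "l \<noteq> c"
    then have "eventually (\<lambda>n. f n \<noteq> c) cofinite"
      using tendsto_imp_eventually_ne[OF l] by (simp add: cofinite_eq_sequentially)
    then show False using that by (simp add: eventually_cofinite)
  qed
  then show ?thesis using assms(2,3) by blast
qed

lemma finite_range_if_lengths_bounded:
  assumes P: "\<And>n. \<sigma> n \<in> perms" and "bdd_above (range (\<lambda>n. len (\<sigma> n)))"
  shows "finite (range \<sigma>)"
proof -
  obtain N where N: "\<And>n. len (\<sigma> n) \<le> N" using assms(2) by (auto simp: bdd_above_def)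
  have "range \<sigma> \<subseteq> Sigma {..N} (\<lambda>n. {\<pi>. \<pi> permutes {1..n}})"
  proof
    fix z assume "z \<in> range \<sigma>"
    then obtain n where "z = \<sigma> n" by blast
    then show "z \<in> Sigma {..N} (\<lambda>n. {\<pi>. \<pi> permutes {1..n}})"
      using N[of n] permsD(2)[OF P[of n]] by (cases "\<sigma> n") simp
  qed
  then show ?thesis by (rule finite_subset) (auto intro: finite_permutations)
qed

text \<open>Some value \<open>v\<close> is taken infinitely often. A second such value would have
  the same density for every pattern; then each of the two occurs in the other, which forces equal
  lengths and equality.\<close>

lemma eventually_constant_if_perm_convergent:
  assumes P: "\<And>n. \<sigma> n \<in> perms" and fin: "finite (range \<sigma>)" and conv: "perm_convergent \<sigma>"
  shows "\<exists>v. eventually (\<lambda>n. \<sigma> n = v) sequentially"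
proof -
  obtain a where a: "infinite {n \<in> UNIV. \<sigma> n = \<sigma> a}"
    using pigeonhole_infinite[OF infinite_UNIV_nat fin] by blast
  define v where "v = \<sigma> a"
  have "finite {n. \<sigma> n \<noteq> v}"
  proof (rule ccontr)
    assume inf: "infinite {n. \<sigma> n \<noteq> v}"
    have "finite (\<sigma> ` {n. \<sigma> n \<noteq> v})" by (rule finite_subset[OF _ fin]) auto
    from pigeonhole_infinite[OF inf this] obtain b where
      b: "\<sigma> b \<noteq> v" "infinite {n \<in> {n. \<sigma> n \<noteq> v}. \<sigma> n = \<sigma> b}" by blast
    have i: "infinite {n. \<sigma> n = v}" "infinite {n. \<sigma> n = \<sigma> b}"
      using a by (simp add: v_def) (rule infinite_super[OF _ b(2)], blast)
    have vp: "v \<in> perms" using P by (simp add: v_def)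
    have eq: "pattern_density \<tau> v = pattern_density \<tau> (\<sigma> b)" if "\<tau> \<in> perms" for \<tau>
    proof (rule convergent_frequent_values_eq)
      show "convergent (\<lambda>n. pattern_density \<tau> (\<sigma> n))" using conv that by (simp add: perm_convergent_def)
      show "infinite {n. pattern_density \<tau> (\<sigma> n) = pattern_density \<tau> v}"
        by (rule infinite_super[OF _ i(1)]) auto
      show "infinite {n. pattern_density \<tau> (\<sigma> n) = pattern_density \<tau> (\<sigma> b)}"
        by (rule infinite_super[OF _ i(2)]) auto
    qed
    have 1: "0 < pattern_density v (\<sigma> b)" using eq[OF vp] pattern_density_self[OF vp] by simp
    have 2: "0 < pattern_density (\<sigma> b) v" using eq[OF P[of b]] pattern_density_self[OF P[of b]] by simp
    have "len v = len (\<sigma> b)" using 1 2 by (auto simp: pattern_density_def split: if_splits)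
    then have "v = \<sigma> b" using perm_eq_if_pattern_density_pos[OF vp P _ 1] by blast
    then show False using b(1) by simp
  qed
  then have "eventually (\<lambda>n. \<sigma> n = v) cofinite" by (simp add: eventually_cofinite)
  then show ?thesis unfolding cofinite_eq_sequentially by blast
qed

text \<open>Distinct values have positive distance, and finitely many positive distances are bounded
  away from 0.\<close>

lemma eventually_constant_if_box_Cauchy:
  assumes P: "\<And>n. \<sigma> n \<in> perms" and fin: "finite (range \<sigma>)" and C: "box_Cauchy \<sigma>"
  shows "\<exists>v. eventually (\<lambda>n. \<sigma> n = v) sequentially"
proof -
  define D where "D = {d_box_perm v w | v w. v \<in> range \<sigma> \<and> w \<in> range \<sigma> \<and> v \<noteq> w}"
  have "D \<subseteq> (\<lambda>(v, w). d_box_perm v w) ` (range \<sigma> \<times> range \<sigma>)" by (auto simp: D_def)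
  then have finD: "finite D" by (rule finite_subset) (use fin in simp)
  have "0 < d" if d: "d \<in> D" for d
  proof -
    obtain i j where "d = d_box_perm (\<sigma> i) (\<sigma> j)" "\<sigma> i \<noteq> \<sigma> j" using d unfolding D_def by blast
    then show ?thesis using perm_eq_if_d_box_0[OF P[of i] P[of j]] by force
  qed
  \<comment> \<open>The element 1 guards against an empty \<open>D\<close>, which arises for a
    constant sequence.\<close>
  then have "0 < Min (insert 1 D)" using finD by simp
  then obtain n0 where n0: "\<And>n m. n \<ge> n0 \<Longrightarrow> m \<ge> n0 \<Longrightarrow> d_box_perm (\<sigma> n) (\<sigma> m) < Min (insert 1 D)"
    using C unfolding box_Cauchy_def by blast
  have "\<sigma> n = \<sigma> n0" if "n \<ge> n0" for n
  proof (rule ccontr)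
    assume "\<sigma> n \<noteq> \<sigma> n0"
    then have "d_box_perm (\<sigma> n) (\<sigma> n0) \<in> D" unfolding D_def by blast
    then have "Min (insert 1 D) \<le> d_box_perm (\<sigma> n) (\<sigma> n0)" using finD by simp
    then show False using n0[OF that order_refl] by simp
  qed
  then show ?thesis unfolding eventually_sequentially by blast
qed

lemma box_Cauchy_if_eventually_constant:
  assumes P: "\<And>n. \<sigma> n \<in> perms" and "eventually (\<lambda>n. \<sigma> n = v) sequentially"
  shows "box_Cauchy \<sigma>"
proof -
  obtain N where N: "\<And>n. n \<ge> N \<Longrightarrow> \<sigma> n = v" using assms(2) by (auto simp: eventually_sequentially)
  have "v \<in> perms" using P[of N] N[of N] by simp
  then have "d_box_perm v v \<le> 0" using d_box_perm_le[of v v 0] by simp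
  then show ?thesis unfolding box_Cauchy_def using N by (metis le_less_trans)
qed

lemma perm_convergent_if_eventually_constant:
  assumes "eventually (\<lambda>n. \<sigma> n = v) sequentially"
  shows "perm_convergent \<sigma>"
  unfolding perm_convergent_def
proof
  fix \<tau> assume "\<tau> \<in> perms"
  have "eventually (\<lambda>n. pattern_density \<tau> v = pattern_density \<tau> (\<sigma> n)) sequentially"
    using assms by eventually_elim simp
  from Lim_transform_eventually[OF tendsto_const this]
  show "convergent (\<lambda>n. pattern_density \<tau> (\<sigma> n))" by (rule convergentI)
qed

theorem theorem1p8:
  fixes \<sigma> :: "nat \<Rightarrow> perm"
  assumes "\<And>n. \<sigma> n \<in> perms"
  shows "(perm_convergent \<sigma> \<longrightarrow> box_Cauchy \<sigma>) \<and>
         (lengths_bounded_or_to_infinity \<sigma> \<longrightarrow> (perm_convergent \<sigma> \<longleftrightarrow> box_Cauchy \<sigma>))"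
proof -
  have bounded: "perm_convergent \<sigma> \<longleftrightarrow> box_Cauchy \<sigma>" if "bdd_above (range (\<lambda>n. len (\<sigma> n)))"
  proof -
    have fin: "finite (range \<sigma>)" by (rule finite_range_if_lengths_bounded[OF assms that])
    show ?thesis
    proof
      assume "perm_convergent \<sigma>"
      then obtain v where "eventually (\<lambda>n. \<sigma> n = v) sequentially"
        using eventually_constant_if_perm_convergent[OF assms fin] by blast
      then show "box_Cauchy \<sigma>" by (rule box_Cauchy_if_eventually_constant[OF assms])
    next
      assume "box_Cauchy \<sigma>"
      then obtain v where "eventually (\<lambda>n. \<sigma> n = v) sequentially"
        using eventually_constant_if_box_Cauchy[OF assms fin] by blast
      then show "perm_convergent \<sigma>" by (rule perm_convergent_if_eventually_constant)
    qed
  qed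
  have unbounded: "perm_convergent \<sigma> \<longleftrightarrow> box_Cauchy \<sigma>"
    if L: "filterlim (\<lambda>n. len (\<sigma> n)) at_top sequentially"
  proof
    assume "perm_convergent \<sigma>"
    then show "box_Cauchy \<sigma>"
      by (intro box_Cauchy_if_perm_cdf_convergent assms L perm_cdf_convergent_if_perm_convergent)
  next
    assume "box_Cauchy \<sigma>"
    then show "perm_convergent \<sigma>"
      by (intro perm_convergent_if_perm_cdf_convergent assms L perm_cdf_convergent_if_box_Cauchy)
  qed
  have "perm_convergent \<sigma> \<longleftrightarrow> box_Cauchy \<sigma>" if "lengths_bounded_or_to_infinity \<sigma>"
    using that bounded unbounded unfolding lengths_bounded_or_to_infinity_def by (elim disjE)
  \<comment> \<open>Convergence itself entails the dichotomy of lengths, which makes the first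
    conjunct unconditional.\<close>
  moreover have "lengths_bounded_or_to_infinity \<sigma>" if "perm_convergent \<sigma>"
    using assms that by (rule lengths_bounded_or_to_infinity_if_perm_convergent)
  ultimately show ?thesis by blast
qed

end
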